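(* Let $K$ be a field and let $n_1,n_2$ be positive integers. Let $L=L_2(n_1,n_2)$ be the Crystal lattice, $R=K[L]$ the polynomial ring whose variables are the elements of $L$, $I_L\subset R$ the join-meet ideal of $L$, and $\mathrm{in}_{\prec}(I_L)$ its initial ideal with respect to the reverse lexicographic order $\prec$ described in the context. Then $$\max\{n_1,n_2\}\;\le\;\mathrm{pd}_R\big(R/\mathrm{in}_{\prec}(I_L)\big)\;\le\; n_1+n_2+1,$$ and for every $i=1,2,\dots,n_1$, $$\binom{n_1}{i}\;\le\;\sum_{j=0}^{\infty}B_{i,j}(n_1,n_2),$$ where $B_{i,j}(n_1,n_2)$ are the graded Betti numbers of the $R$-module $R/\mathrm{in}_{\prec}(I_L)$ (so the right-hand side is its $i$-th total Betti number).
   Context: For positive integers $n_1,n_2$, the Crystal lattice $L_2(n_1,n_2)$ is the finite lattice $\{s,x_{1,1},\dots,x_{1,n_1},x_{2,1},\dots,x_{2,n_2},t\}$ (all listed elements distinct) whose order relations are exactly those generated by $s<x_{i,1}<x_{i,2}<\cdots<x_{i,n_i}<t$ for $i=1,2$; elements $x_{1,r}$ and $x_{2,q}$ are incomparable, with join $t$ and meet $s$. For a finite lattice $L$, $K[L]$ is the polynomial ring over $K$ whose variables are the elements of $L$, and the join-meet ideal of $L$ is $$I_L=\big(\{ab-(a\vee b)(a\wedge b)\mid a,b\in L\}\big)\subset K[L].$$ The monomial order $\prec$ on $K[L]$ is the (graded) reverse lexicographic order induced by the ordering of variables $$s\prec x_{1,1}\prec\cdots\prec x_{1,n_1}\prec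 x_{2,1}\prec\cdots\prec x_{2,n_2}\prec t,$$ that is, $u\prec v$ for monomials $u\ne v$ if $\deg u<\deg v$, or if $\deg u=\deg v$ and, for the smallest variable whose exponents in $u$ and $v$ differ, its exponent in $u$ is larger than its exponent in $v$. The initial ideal $\mathrm{in}_{\prec}(I_L)$ is the ideal generated by the $\prec$-largest monomials of the nonzero elements of $I_L$. With $R=K[L]$ standard graded, the minimal graded free resolution of $R/\mathrm{in}_{\prec}(I_L)$ has $i$-th term $\bigoplus_j R(-j)^{B_{i,j}(n_1,n_2)}$ (with $0$-th term $R$); $\mathrm{pd}_R$ denotes its length, the projective dimension. *)

theory Defs
  imports
    Complex_Main
    "HOL-Library.Poly_Mapping"
    "HOL-Library.Extended_Nat"
    "HOL-Library.Cardinality"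
    "Jordan_Normal_Form.Matrix_Kernel"
begin

section \<open>Crystal lattices\<close>

text \<open>
  The index types \<open>'a\<close> and \<open>'b\<close> are finite linear orders; with \<open>CARD('a) = n\<^sub>1\<close> and
  \<open>CARD('b) = n\<^sub>2\<close>, the elements \<open>Cx1 r\<close> (\<open>r :: 'a\<close>) are \<open>x\<^bsub>1,1\<^esub> < \<dots> < x\<^bsub>1,n\<^sub>1\<^esub>\<close>
  in the order of \<open>'a\<close>, and likewise \<open>Cx2 q\<close> (\<open>q :: 'b\<close>) are the \<open>x\<^bsub>2,q\<^esub>\<close>.
\<close>

datatype ('a, 'b) crystal = Cs | Cx1 'a | Cx2 'b | Ct

instance crystal :: (finite, finite) finite
proof
  have "(UNIV :: ('a::finite, 'b::finite) crystal set) = {Cs, Ct} \<union> range Cx1 \<union> range Cx2"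
    by (auto intro: crystal.exhaust)
  moreover have "finite ({Cs, Ct} \<union> range Cx1 \<union> range Cx2 :: ('a, 'b) crystal set)"
    by simp
  ultimately show "finite (UNIV :: ('a, 'b) crystal set)"
    by simp
qed

instantiation crystal :: (linorder, linorder) lattice
begin

fun less_eq_crystal :: "('a, 'b) crystal \<Rightarrow> ('a, 'b) crystal \<Rightarrow> bool" where
  "less_eq_crystal Cs v = True"
| "less_eq_crystal (Cx1 r) (Cx1 r') = (r \<le> r')"
| "less_eq_crystal (Cx2 q) (Cx2 q') = (q \<le> q')"
| "less_eq_crystal u Ct = True"
| "less_eq_crystal u v = False"

definition less_crystal :: "('a, 'b) crystal \<Rightarrow> ('a, 'b) crystal \<Rightarrow> bool" where
  "less_crystal u v \<longleftrightarrow> u \<le> v \<and> \<not> v \<le> u"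

fun sup_crystal :: "('a, 'b) crystal \<Rightarrow> ('a, 'b) crystal \<Rightarrow> ('a, 'b) crystal" where
  "sup_crystal Cs v = v"
| "sup_crystal u Cs = u"
| "sup_crystal (Cx1 r) (Cx1 r') = Cx1 (max r r')"
| "sup_crystal (Cx2 q) (Cx2 q') = Cx2 (max q q')"
| "sup_crystal u v = Ct"

fun inf_crystal :: "('a, 'b) crystal \<Rightarrow> ('a, 'b) crystal \<Rightarrow> ('a, 'b) crystal" where
  "inf_crystal Ct v = v"
| "inf_crystal u Ct = u"
| "inf_crystal (Cx1 r) (Cx1 r') = Cx1 (min r r')"
| "inf_crystal (Cx2 q) (Cx2 q') = Cx2 (min q q')"
| "inf_crystal u v = Cs"

instance
proof
  fix x y z :: "('a, 'b) crystal"
  show "x < y \<longleftrightarrow> x \<le> y \<and> \<not> y \<le> x"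
    by (simp add: less_crystal_def)
  show "x \<le> x"
    by (cases x) auto
  show "x \<le> y \<Longrightarrow> y \<le> z \<Longrightarrow> x \<le> z"
    by (cases x; cases y; cases z) auto
  show "x \<le> y \<Longrightarrow> y \<le> x \<Longrightarrow> x = y"
    by (cases x; cases y) auto
  show "inf x y \<le> x" "inf x y \<le> y" "x \<le> sup x y" "y \<le> sup x y"
    by (cases x; cases y; auto)+
  show "x \<le> y \<Longrightarrow> x \<le> z \<Longrightarrow> x \<le> inf y z"
    by (cases x; cases y; cases z) auto
  show "y \<le> x \<Longrightarrow> z \<le> x \<Longrightarrow> sup y z \<le> x"
    by (cases x; cases y; cases z) auto
qed

end

text \<open>The ordering of variables, a linear extension of the lattice order:
  \<open>s\<close>, then all \<open>x\<^bsub>1,r\<^esub>\<close>, then all \<open>x\<^bsub>2,q\<^esub>\<close>, then \<open>t\<close>.\<close>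

fun crystal_var_less :: "('a::linorder, 'b::linorder) crystal \<Rightarrow> ('a, 'b) crystal \<Rightarrow> bool" where
  "crystal_var_less u Cs = False"
| "crystal_var_less u (Cx1 r) = (u = Cs \<or> (\<exists>r'. u = Cx1 r' \<and> r' < r))"
| "crystal_var_less u (Cx2 q) = (u = Cs \<or> (\<exists>r. u = Cx1 r) \<or> (\<exists>q'. u = Cx2 q' \<and> q' < q))"
| "crystal_var_less u Ct = (u \<noteq> Ct)"


section \<open>Polynomials, join-meet ideals and initial ideals\<close>

text \<open>Polynomials over \<open>'k\<close> whose variables are exactly the elements of \<open>'v\<close>.\<close>

type_synonym ('v, 'k) mpoly = "('v \<Rightarrow>\<^sub>0 nat) \<Rightarrow>\<^sub>0 'k"

definition mpvar :: "'v \<Rightarrow> ('v, 'k::comm_ring_1) mpoly" where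
  "mpvar x = Poly_Mapping.single (Poly_Mapping.single x 1) 1"

definition mono_deg :: "('v \<Rightarrow>\<^sub>0 nat) \<Rightarrow> nat" where
  "mono_deg m = (\<Sum>x\<in>Poly_Mapping.keys m. Poly_Mapping.lookup m x)"

text \<open>The ideal generated by a set is its span in the ring regarded as a module over itself.\<close>

definition ideal_gen :: "'r::comm_ring_1 set \<Rightarrow> 'r set" where
  "ideal_gen G = Modules.module.span (*) G"

definition join_meet_ideal :: "('l::{finite,lattice}, 'k::field) mpoly set" where
  "join_meet_ideal = ideal_gen {mpvar a * mpvar b - mpvar (sup a b) * mpvar (inf a b) | a b. True}"

text \<open>The strict graded reverse lexicographic order \<open>u \<prec> v\<close> induced by a strict
  linear order \<open>vless\<close> of the variables.\<close>

definition revlex_less :: "('v \<Rightarrow> 'v \<Rightarrow> bool) \<Rightarrow> ('v \<Rightarrow>\<^sub>0 nat) \<Rightarrow> ('v \<Rightarrow>\<^sub>0 nat) \<Rightarrow> bool" where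
  "revlex_less vless u v \<longleftrightarrow>
     mono_deg u < mono_deg v \<or>
     (mono_deg u = mono_deg v \<and>
       (\<exists>x. Poly_Mapping.lookup u x > Poly_Mapping.lookup v x \<and>
            (\<forall>y. vless y x \<longrightarrow> Poly_Mapping.lookup u y = Poly_Mapping.lookup v y)))"

definition is_leading_monomial ::
    "(('v \<Rightarrow>\<^sub>0 nat) \<Rightarrow> ('v \<Rightarrow>\<^sub>0 nat) \<Rightarrow> bool) \<Rightarrow> ('v, 'k::zero) mpoly \<Rightarrow> ('v \<Rightarrow>\<^sub>0 nat) \<Rightarrow> bool" where
  "is_leading_monomial mless f m \<longleftrightarrow>
     m \<in> Poly_Mapping.keys f \<and> (\<forall>m'\<in>Poly_Mapping.keys f. m' \<noteq> m \<longrightarrow> mless m' m)"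

definition initial_ideal ::
    "(('v \<Rightarrow>\<^sub>0 nat) \<Rightarrow> ('v \<Rightarrow>\<^sub>0 nat) \<Rightarrow> bool) \<Rightarrow> ('v, 'k::field) mpoly set \<Rightarrow> ('v, 'k) mpoly set" where
  "initial_ideal mless I =
     ideal_gen {Poly_Mapping.single m 1 | m. \<exists>f\<in>I. f \<noteq> 0 \<and> is_leading_monomial mless f m}"

definition crystal_initial_ideal :: "(('a::{finite,linorder}, 'b::{finite,linorder}) crystal, 'k::field) mpoly set" where
  "crystal_initial_ideal = initial_ideal (revlex_less crystal_var_less) join_meet_ideal"


section \<open>Minimal graded free resolutions of quotients \<open>R/I\<close>\<close>

text \<open>
  A complex of finitely generated graded free modules is given by lists of degree shifts and
  matrices: the \<open>i\<close>-th term is the direct sum of the \<open>R(-d)\<close> for \<open>d\<close> in the list \<open>D i\<close>,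
  and \<open>A i\<close> (used for \<open>i \<ge> 1\<close>) is the matrix of the map from the \<open>i\<close>-th to the \<open>(i-1)\<close>-th term.
  The map has degree \<open>0\<close> iff every nonzero entry in row \<open>l\<close> and column \<open>k\<close> is homogeneous
  of degree \<open>D i ! k - D (i-1) ! l\<close>.  The complex may be infinite; it has length \<open>\<le> p\<close>
  iff \<open>D i = []\<close> for all \<open>i > p\<close>.
  Natural numbers suffice as shifts, since the \<open>0\<close>-th term is \<open>R\<close> and the maps are minimal.
\<close>

definition minimal_graded_free_resolution ::
    "('v, 'k::field) mpoly set \<Rightarrow> (nat \<Rightarrow> nat list) \<Rightarrow> (nat \<Rightarrow> ('v, 'k) mpoly mat) \<Rightarrow> bool" where
  "minimal_graded_free_resolution I D A \<longleftrightarrow>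
     D 0 = [0] \<and>
     (\<forall>i. A (Suc i) \<in> carrier_mat (length (D i)) (length (D (Suc i)))) \<and>
     \<comment> \<open>the maps are homogeneous of degree \<open>0\<close>\<close>
     (\<forall>i. \<forall>l < length (D i). \<forall>k < length (D (Suc i)).
        \<forall>m \<in> Poly_Mapping.keys (A (Suc i) $$ (l, k)). mono_deg m + D i ! l = D (Suc i) ! k) \<and>
     \<comment> \<open>exactness of \<open>F\<^sub>1 \<rightarrow> R \<rightarrow> R/I \<rightarrow> 0\<close>\<close>
     {(A 1 *\<^sub>v v) $ 0 | v. v \<in> carrier_vec (length (D 1))} = I \<and>
     \<comment> \<open>exactness at \<open>F\<^bsub>i+1\<^esub>\<close>\<close>
     (\<forall>i. mat_kernel (A (Suc i)) =
        {A (Suc (Suc i)) *\<^sub>v v | v. v \<in> carrier_vec (length (D (Suc (Suc i))))}) \<and>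
     \<comment> \<open>minimality: the entries lie in the irrelevant maximal ideal\<close>
     (\<forall>i. elements_mat (A (Suc i)) \<subseteq> ideal_gen (range mpvar))"

text \<open>The shifts in the minimal graded free resolution of \<open>R/I\<close>, for a homogeneous ideal \<open>I\<close> in
  finitely many variables; the resolution is unique up to isomorphism, so for each \<open>i\<close> the list
  of shifts is determined up to order, and the next two notions do not depend on the choice.\<close>

definition minimal_shifts :: "('v, 'k::field) mpoly set \<Rightarrow> nat \<Rightarrow> nat list" where
  "minimal_shifts I = (SOME D. \<exists>A. minimal_graded_free_resolution I D A)"

definition graded_betti_quot :: "('v, 'k::field) mpoly set \<Rightarrow> nat \<Rightarrow> nat \<Rightarrow> nat" where
  "graded_betti_quot I i j = count_list (minimal_shifts I i) j"

definition proj_dim_quot :: "('v, 'k::field) mpoly set \<Rightarrow> enat" where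
  "proj_dim_quot I = (SUP i\<in>{i. minimal_shifts I i \<noteq> []}. enat i)"

end

(*
  A Groebner basis of I_L consists of x_{1,r} x_{2,q} - s t, s t x_{1,r} - s t x_{1,1} and
  s t x_{2,q} - s t x_{2,1} (r, q >= 2).  The initial ideal is therefore generated by the
  squarefree monomials x_{1,r} x_{2,q}, s t x_{1,r} and s t x_{2,q} (r, q >= 2).  In this order
  they have linear quotients: each colon ideal of the previous generators by the next one is
  generated by variables.  Iterated mapping cones over Koszul complexes then give a minimal
  resolution whose (i+1)-st rank is the sum of the binomials (c choose i), where c runs through
  the numbers of variables generating the colon ideals.  The generators x_{1,r} x_{2,1}
  contribute c = r - 1, which yields (n_1 choose i+1); the last x_{1,r} x_{2,q} has
  c = n_1 + n_2 - 2, and c <= n_1 + n_2 for all of them.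
*)

theory Submission
  imports Defs "HOL-Library.Product_Lexorder"
begin

section \<open>Polynomials and squarefree monomial ideals\<close>

text \<open>Two obstacles shape the proof. Betti numbers and projective dimension are read off a
  resolution picked by \<open>SOME\<close>, so one explicit resolution does not suffice: comparison
  maps and homotopies show that any two minimal resolutions have the same ranks. Moreover, a mapping
  cone of minimal resolutions need not be minimal, because the comparison map may have nonzero
  constant entries. Degrees exclude this. If the new generator has degree d and the earlier ones
  have degree at most d, then the shifts in step i >= 1 of the old resolution are at most d + i - 1,
  while those of the Koszul complex moved by d are d + i. The initial ideal is found without S-pair
  reductions. I_L is generated by differences of monomials, so for every congruence class of
  monomials the sum of the coefficients over the class vanishes on I_L. A monomial outside the
  proposed ideal is the smallest of its class; if it led some f in I_L, it would be the only
  monomial of f in its class, so its coefficient would vanish. The lower bound on the length comes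
  from x_{1,n_1} x_{2,n_2}, which makes the term in step n_1 + n_2 - 1 nonzero.\<close>

definition filter_poly :: "('m \<Rightarrow> bool) \<Rightarrow> ('m \<Rightarrow>\<^sub>0 'k::zero) \<Rightarrow> 'm \<Rightarrow>\<^sub>0 'k" where
  "filter_poly P f = Poly_Mapping.mapp (\<lambda>u c. c when P u) f"

lemma lookup_filter_poly: "Poly_Mapping.lookup (filter_poly P f) u = (Poly_Mapping.lookup f u when P u)"
  by (auto simp: filter_poly_def Poly_Mapping.lookup_mapp when_def in_keys_iff)

lemma keys_filter_poly: "Poly_Mapping.keys (filter_poly P f) = {u \<in> Poly_Mapping.keys f. P u}"
  by (auto simp: in_keys_iff lookup_filter_poly)

lemma filter_poly_id: "(\<And>u. u \<in> Poly_Mapping.keys f \<Longrightarrow> P u) \<Longrightarrow> filter_poly P f = f"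
  by (rule poly_mapping_eqI) (auto simp: lookup_filter_poly when_def in_keys_iff)

lemma filter_poly_0: "(\<And>u. u \<in> Poly_Mapping.keys f \<Longrightarrow> \<not> P u) \<Longrightarrow> filter_poly P f = 0"
  by (rule poly_mapping_eqI) (auto simp: lookup_filter_poly when_def in_keys_iff)

lemma filter_poly_add: "filter_poly P (f + g) = filter_poly P f + filter_poly P (g :: 'm \<Rightarrow>\<^sub>0 'k::comm_monoid_add)"
  by (rule poly_mapping_eqI) (simp add: lookup_filter_poly lookup_add when_def)

lemma filter_poly_sum: "filter_poly P (sum f A) = (\<Sum>i\<in>A. filter_poly P (f i :: 'm \<Rightarrow>\<^sub>0 'k::comm_monoid_add))"
  by (rule poly_mapping_eqI) (simp add: lookup_filter_poly lookup_sum when_def)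

lemma filter_poly_split: "filter_poly P f + filter_poly (\<lambda>u. \<not> P u) f = (f :: 'm \<Rightarrow>\<^sub>0 'k::comm_monoid_add)"
  by (rule poly_mapping_eqI) (simp add: lookup_filter_poly lookup_add when_def)

text \<open>Split \<open>w\<close> by \<open>Q\<close>: all terms of \<open>a\<close> times the
  first part satisfy \<open>P\<close>, none of \<open>a\<close> times the second do. The typical
  case is \<open>a\<close> homogeneous, with \<open>P\<close> and \<open>Q\<close> prescribing
  degrees.\<close>

lemma filter_poly_mult:
  fixes a w :: "'m::comm_monoid_add \<Rightarrow>\<^sub>0 'k::comm_ring_1"
  assumes "\<And>p u. p \<in> Poly_Mapping.keys a \<Longrightarrow> P (p + u) = Q u"
  shows "filter_poly P (a * w) = a * filter_poly Q w"
proof -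
  have "filter_poly P (a * filter_poly Q w) = a * filter_poly Q w"
    using assms keys_mult[of a "filter_poly Q w"] by (intro filter_poly_id) (auto simp: keys_filter_poly)
  moreover have "filter_poly P (a * filter_poly (\<lambda>u. \<not> Q u) w) = 0"
    using assms keys_mult[of a "filter_poly (\<lambda>u. \<not> Q u) w"] by (intro filter_poly_0) (auto simp: keys_filter_poly)
  ultimately show ?thesis
    using filter_poly_split[of Q w] filter_poly_add[of P "a * filter_poly Q w" "a * filter_poly (\<lambda>u. \<not> Q u) w"]
    by (simp add: distrib_left[symmetric])
qed

section \<open>Degrees and constant terms\<close>

lemma mono_deg_eq_sum:
  fixes u :: "'v \<Rightarrow>\<^sub>0 nat"
  assumes "finite A" "Poly_Mapping.keys u \<subseteq> A"
  shows "mono_deg u = (\<Sum>x\<in>A. Poly_Mapping.lookup u x)"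
  unfolding mono_deg_def by (rule sum.mono_neutral_left) (use assms in \<open>auto simp: in_keys_iff\<close>)

lemma mono_deg_add: "mono_deg (u + v) = mono_deg u + mono_deg v"
proof -
  let ?A = "Poly_Mapping.keys u \<union> Poly_Mapping.keys v"
  have "mono_deg (u + v) = (\<Sum>x\<in>?A. Poly_Mapping.lookup (u + v) x)"
    by (rule mono_deg_eq_sum) (use Poly_Mapping.keys_add[of u v] in auto)
  also have "\<dots> = mono_deg u + mono_deg v"
    by (simp add: lookup_add sum.distrib mono_deg_eq_sum[of ?A])
  finally show ?thesis .
qed

lemma mono_deg_0 [simp]: "mono_deg 0 = 0"
  by (simp add: mono_deg_def)

lemma mono_deg_eq_0_iff: "mono_deg u = 0 \<longleftrightarrow> u = 0"
  by (auto simp: mono_deg_def in_keys_iff intro!: poly_mapping_eqI)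

text \<open>Exponents are natural numbers, so a product of two monomials is 1 only if both are.
  Hence reduction modulo the variables is multiplicative, which is what allows matrices to be
  reduced to the field.\<close>

lemma lookup_0_mult:
  fixes f g :: "('v \<Rightarrow>\<^sub>0 nat) \<Rightarrow>\<^sub>0 'k::comm_ring_1"
  shows "Poly_Mapping.lookup (f * g) 0 = Poly_Mapping.lookup f 0 * Poly_Mapping.lookup g 0"
proof -
  let ?f0 = "filter_poly (\<lambda>u. u = 0) f" and ?f1 = "filter_poly (\<lambda>u. u \<noteq> 0) f"
  let ?g0 = "filter_poly (\<lambda>u. u = 0) g" and ?g1 = "filter_poly (\<lambda>u. u \<noteq> 0) g"
  have zero: "p + u \<noteq> 0" if "p \<noteq> 0 \<or> u \<noteq> 0" for p u :: "'v \<Rightarrow>\<^sub>0 nat"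
    using that mono_deg_add[of p u] by (metis add_is_0 mono_deg_eq_0_iff)
  have f0: "filter_poly (\<lambda>u. u = 0) h = Poly_Mapping.single 0 (Poly_Mapping.lookup h 0)"
    for h :: "('v \<Rightarrow>\<^sub>0 nat) \<Rightarrow>\<^sub>0 'k"
    by (rule poly_mapping_eqI) (auto simp: lookup_filter_poly lookup_single when_def)
  have "f * g = (?f0 + ?f1) * g"
    by (simp only: filter_poly_split)
  also have "\<dots> = ?f0 * (?g0 + ?g1) + ?f1 * g"
    unfolding distrib_right by (simp only: filter_poly_split)
  finally have e: "f * g = ?f0 * ?g0 + (?f0 * ?g1 + ?f1 * g)"
    by (simp only: distrib_left add.assoc)
  have "0 \<notin> Poly_Mapping.keys (?f0 * ?g1)"
    using keys_mult[of ?f0 ?g1] zero by (auto simp: keys_filter_poly dest!: subsetD)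
  moreover have "0 \<notin> Poly_Mapping.keys (?f1 * g)"
    using keys_mult[of ?f1 g] zero by (auto simp: keys_filter_poly dest!: subsetD)
  ultimately have "Poly_Mapping.lookup (f * g) 0 = Poly_Mapping.lookup (?f0 * ?g0) 0"
    by (subst e) (auto simp: lookup_add in_keys_iff)
  then show ?thesis
    unfolding f0 by (simp add: mult_single lookup_single)
qed

section \<open>Ideals as spans, and monomial ideals\<close>

lemma module_mult: "Modules.module ((*) :: 'r::comm_ring_1 \<Rightarrow> 'r \<Rightarrow> 'r)"
  by unfold_locales (simp_all add: algebra_simps)

lemmas ideal_gen_base = Modules.module.span_base[OF module_mult, folded ideal_gen_def]
lemmas ideal_gen_diff = Modules.module.span_diff[OF module_mult, folded ideal_gen_def]
lemmas ideal_gen_mult = Modules.module.span_scale[OF module_mult, folded ideal_gen_def]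
lemmas ideal_gen_sum = Modules.module.span_sum[OF module_mult, folded ideal_gen_def]
lemmas ideal_gen_minimal = Modules.module.span_minimal[OF module_mult, folded ideal_gen_def]

lemma poly_mapping_sum_single:
  "f = (\<Sum>u\<in>Poly_Mapping.keys f. Poly_Mapping.single u (Poly_Mapping.lookup f u :: 'k::comm_monoid_add))"
  by (rule poly_mapping_eqI)
    (simp add: lookup_sum lookup_single when_def in_keys_iff sum.delta[OF finite_keys])

text \<open>Membership in a monomial ideal is decided term by term: the right-hand side is closed
  under the ideal operations, and conversely f is the sum of its terms, each a multiple of a
  generator. From here on ideals are handled through supports of monomials.\<close>

lemma ideal_gen_monomials:
  fixes M :: "('v \<Rightarrow>\<^sub>0 nat) set"
  shows "ideal_gen {Poly_Mapping.single m (1 :: 'k::comm_ring_1) | m. m \<in> M} =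
    {f. \<forall>k\<in>Poly_Mapping.keys f. \<exists>m\<in>M. \<exists>u. k = m + u}" (is "?L = ?R")
proof
  have "Modules.module.subspace (*) ?R"
    unfolding Modules.module.subspace_def[OF module_mult]
  proof (safe; (simp; fail)?)
    fix f g :: "('v \<Rightarrow>\<^sub>0 nat) \<Rightarrow>\<^sub>0 'k" and k
    assume f: "\<forall>k\<in>Poly_Mapping.keys f. \<exists>m\<in>M. \<exists>u. k = m + u"
      and g: "\<forall>k\<in>Poly_Mapping.keys g. \<exists>m\<in>M. \<exists>u. k = m + u"
      and "k \<in> Poly_Mapping.keys (f + g)"
    then show "\<exists>m\<in>M. \<exists>u. k = m + u"
      using Poly_Mapping.keys_add[of f g] by blast
  next
    fix c f :: "('v \<Rightarrow>\<^sub>0 nat) \<Rightarrow>\<^sub>0 'k" and k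
    assume f: "\<forall>k\<in>Poly_Mapping.keys f. \<exists>m\<in>M. \<exists>u. k = m + u"
      and "k \<in> Poly_Mapping.keys (c * f)"
    then obtain a b where "k = a + b" "b \<in> Poly_Mapping.keys f"
      using keys_mult[of c f] by blast
    with f show "\<exists>m\<in>M. \<exists>u. k = m + u"
      by (metis add.left_commute)
  qed
  then show "?L \<subseteq> ?R"
    by (intro ideal_gen_minimal) (auto intro!: bexI exI[of _ 0])
  show "?R \<subseteq> ?L"
  proof safe
    fix f :: "('v \<Rightarrow>\<^sub>0 nat) \<Rightarrow>\<^sub>0 'k"
    assume f: "\<forall>k\<in>Poly_Mapping.keys f. \<exists>m\<in>M. \<exists>u. k = m + u"
    have "(\<Sum>k\<in>Poly_Mapping.keys f. Poly_Mapping.single k (Poly_Mapping.lookup f k)) \<in> ?L"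
    proof (rule ideal_gen_sum)
      fix k assume "k \<in> Poly_Mapping.keys f"
      then obtain m u where "m \<in> M" "k = m + u"
        using f by blast
      then have "Poly_Mapping.single k (Poly_Mapping.lookup f k) =
          Poly_Mapping.single u (Poly_Mapping.lookup f k) * Poly_Mapping.single m 1"
        by (simp add: mult_single add.commute)
      then show "Poly_Mapping.single k (Poly_Mapping.lookup f k) \<in> ?L"
        using \<open>m \<in> M\<close> by (simp only:) (intro ideal_gen_mult ideal_gen_base, blast)
    qed
    then show "f \<in> ?L"
      using poly_mapping_sum_single[of f] by simp
  qed
qed

text \<open>Every monomial other than 1 is divisible by a variable. Minimality of a resolution thus
  means that no matrix entry has a constant term.\<close>

lemma irrelevant_ideal_eq:
  "ideal_gen (range mpvar) = {f :: ('v, 'k::comm_ring_1) mpoly. Poly_Mapping.lookup f 0 = 0}"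
proof -
  have "range mpvar = {Poly_Mapping.single m (1 :: 'k) | m. m \<in> range (\<lambda>x :: 'v. Poly_Mapping.single x 1)}"
    by (auto simp: mpvar_def)
  moreover have "(\<exists>m\<in>range (\<lambda>x :: 'v. Poly_Mapping.single x 1). \<exists>u. k = m + u) \<longleftrightarrow> k \<noteq> 0"
    for k :: "'v \<Rightarrow>\<^sub>0 nat"
  proof
    assume "\<exists>m\<in>range (\<lambda>x :: 'v. Poly_Mapping.single x 1). \<exists>u. k = m + u"
    then obtain x u where "k = Poly_Mapping.single x 1 + u"
      by blast
    then have "Poly_Mapping.lookup k x \<noteq> 0"
      by (simp add: lookup_add)
    then show "k \<noteq> 0"
      by auto
  next
    assume "k \<noteq> 0"
    then obtain x where "Poly_Mapping.lookup k x \<noteq> 0"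
      by (metis lookup_zero poly_mapping_eqI)
    then have "k = Poly_Mapping.single x 1 + (k - Poly_Mapping.single x 1)"
      by (intro poly_mapping_eqI) (auto simp: lookup_add lookup_minus lookup_single when_def)
    then show "\<exists>m\<in>range (\<lambda>x :: 'v. Poly_Mapping.single x 1). \<exists>u. k = m + u"
      by blast
  qed
  ultimately show ?thesis
    by (auto simp: ideal_gen_monomials in_keys_iff)
qed

section \<open>Squarefree monomials, sums and colon ideals\<close>

definition sqfree_mono :: "'v::finite set \<Rightarrow> 'v \<Rightarrow>\<^sub>0 nat" where
  "sqfree_mono V = Abs_poly_mapping (\<lambda>x. of_bool (x \<in> V))"

lemma lookup_sqfree_mono: "Poly_Mapping.lookup (sqfree_mono V) x = of_bool (x \<in> V)"
  by (simp add: sqfree_mono_def lookup_Abs_poly_mapping)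

lemma keys_sqfree_mono [simp]: "Poly_Mapping.keys (sqfree_mono V) = V"
  by (auto simp: in_keys_iff lookup_sqfree_mono)

lemma mono_deg_sqfree_mono [simp]: "mono_deg (sqfree_mono V) = card V"
  by (simp add: mono_deg_def lookup_sqfree_mono)

lemma keys_add_nat: "Poly_Mapping.keys (u + v) = Poly_Mapping.keys u \<union> Poly_Mapping.keys (v :: 'v \<Rightarrow>\<^sub>0 nat)"
  by (auto simp: in_keys_iff lookup_add)

lemma sqfree_mono_dvd_iff: "(\<exists>u. k = sqfree_mono V + u) \<longleftrightarrow> V \<subseteq> Poly_Mapping.keys k"
proof
  assume "V \<subseteq> Poly_Mapping.keys k"
  then have "k = sqfree_mono V + (k - sqfree_mono V)"
    by (intro poly_mapping_eqI) (auto simp: lookup_add lookup_minus lookup_sqfree_mono in_keys_iff subset_iff)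
  then show "\<exists>u. k = sqfree_mono V + u" ..
qed (auto simp: keys_add_nat)

text \<open>The ideal generated by the squarefree monomials with supports in \<open>\<V>\<close>.
  The termwise form avoids spans and turns divisibility into inclusion of supports.\<close>

definition sqfree_ideal :: "'v set set \<Rightarrow> ('v, 'k::comm_ring_1) mpoly set" where
  "sqfree_ideal \<V> = {f. \<forall>k\<in>Poly_Mapping.keys f. \<exists>V\<in>\<V>. V \<subseteq> Poly_Mapping.keys k}"

text \<open>Multiplication by a monomial shifts exponents injectively, so nothing cancels; the
  coefficient at \<open>u + m\<close> is isolated with \<open>filter_poly\<close>.\<close>

lemma keys_mult_single_1:
  fixes f :: "('v \<Rightarrow>\<^sub>0 nat) \<Rightarrow>\<^sub>0 'k::comm_ring_1"
  shows "Poly_Mapping.keys (f * Poly_Mapping.single m 1) = (\<lambda>u. u + m) ` Poly_Mapping.keys f"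
proof (intro equalityI subsetI)
  show "u \<in> (\<lambda>u. u + m) ` Poly_Mapping.keys f" if "u \<in> Poly_Mapping.keys (f * Poly_Mapping.single m 1)" for u
    using that keys_mult[of f "Poly_Mapping.single m 1"] by (auto split: if_splits)
  fix v assume "v \<in> (\<lambda>u. u + m) ` Poly_Mapping.keys f"
  then obtain u where u: "v = u + m" "u \<in> Poly_Mapping.keys f" by auto
  have "Poly_Mapping.lookup (f * Poly_Mapping.single m 1) (u + m) = Poly_Mapping.lookup f u"
  proof -
    have "filter_poly (\<lambda>w. w = u + m) (Poly_Mapping.single m 1 * f) =
        Poly_Mapping.single m 1 * filter_poly (\<lambda>w. w = u) f"
      by (rule filter_poly_mult) (auto simp: add.commute[of _ m] split: if_splits)
    also have "filter_poly (\<lambda>w. w = u) f = Poly_Mapping.single u (Poly_Mapping.lookup f u)"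
      by (rule poly_mapping_eqI) (auto simp: lookup_filter_poly lookup_single when_def)
    finally have "Poly_Mapping.lookup (filter_poly (\<lambda>w. w = u + m) (Poly_Mapping.single m 1 * f)) (u + m) =
        Poly_Mapping.lookup f u"
      by (simp add: mult_single add.commute[of m] lookup_single)
    then show ?thesis
      by (simp add: lookup_filter_poly mult.commute)
  qed
  then show "v \<in> Poly_Mapping.keys (f * Poly_Mapping.single m 1)"
    using u by (simp add: in_keys_iff)
qed

text \<open>The left-hand side is the shape in which a mapping cone presents its ideal. For the
  reverse inclusion, the terms divisible by the new monomial form the multiple \<open>g\<close>, and
  the remaining terms need an old generator.\<close>

lemma sqfree_ideal_insert:
  fixes \<V> :: "'v::finite set set"
  shows "{f + g * Poly_Mapping.single (sqfree_mono V) (1::'k::comm_ring_1) | f g. f \<in> sqfree_ideal \<V>} =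
    sqfree_ideal (insert V \<V>)" (is "?L = ?R")
proof
  show "?L \<subseteq> ?R"
  proof safe
    fix f g :: "('v, 'k) mpoly"
    assume f: "f \<in> sqfree_ideal \<V>"
    have "\<exists>W\<in>insert V \<V>. W \<subseteq> Poly_Mapping.keys k"
      if "k \<in> Poly_Mapping.keys (f + g * Poly_Mapping.single (sqfree_mono V) 1)" for k
    proof (cases "k \<in> Poly_Mapping.keys f")
      case True
      with f show ?thesis by (auto simp: sqfree_ideal_def)
    next
      case False
      then have "k \<in> Poly_Mapping.keys (g * Poly_Mapping.single (sqfree_mono V) 1)"
        using that Poly_Mapping.keys_add[of f "g * Poly_Mapping.single (sqfree_mono V) 1"] by blast
      then show ?thesis
        by (auto simp: keys_mult_single_1 keys_add_nat)
    qed
    then show "f + g * Poly_Mapping.single (sqfree_mono V) 1 \<in> ?R"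
      by (simp add: sqfree_ideal_def)
  qed
  show "?R \<subseteq> ?L"
  proof
    fix h :: "('v, 'k) mpoly"
    assume h: "h \<in> ?R"
    let ?P = "\<lambda>k. V \<subseteq> Poly_Mapping.keys k"
    have "filter_poly ?P h \<in> ideal_gen {Poly_Mapping.single m (1 :: 'k) | m. m \<in> {sqfree_mono V}}"
      unfolding ideal_gen_monomials by (auto simp: keys_filter_poly sqfree_mono_dvd_iff)
    then obtain g where "filter_poly ?P h = g * Poly_Mapping.single (sqfree_mono V) 1"
      by (auto simp: ideal_gen_def Modules.module.span_singleton[OF module_mult])
    moreover have "filter_poly (\<lambda>k. \<not> ?P k) h \<in> sqfree_ideal \<V>"
      using h by (auto simp: sqfree_ideal_def keys_filter_poly)
    ultimately have "h = filter_poly (\<lambda>k. \<not> ?P k) h + g * Poly_Mapping.single (sqfree_mono V) 1 \<and>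
        filter_poly (\<lambda>k. \<not> ?P k) h \<in> sqfree_ideal \<V>"
      using filter_poly_split[of ?P h] by (simp add: add.commute)
    then show "h \<in> ?L"
      by blast
  qed
qed

text \<open>The assumption is the combinatorial form of "the colon ideal by the monomial of
  \<open>V\<close> is generated by the variables in \<open>S\<close>": \<open>T\<close> stands for
  the support of a cofactor, and the support of a product is the union of the supports.\<close>

lemma sqfree_ideal_colon:
  fixes \<V> :: "'v::finite set set"
  assumes "\<And>T. (\<exists>W\<in>\<V>. W \<subseteq> T \<union> V) \<longleftrightarrow> T \<inter> S \<noteq> {}"
  shows "f * Poly_Mapping.single (sqfree_mono V) 1 \<in> sqfree_ideal \<V> \<longleftrightarrow>
    f \<in> sqfree_ideal ((\<lambda>x. {x}) ` S)"
proof -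
  have "(\<exists>W\<in>(\<lambda>x. {x}) ` S. W \<subseteq> Poly_Mapping.keys k) \<longleftrightarrow> Poly_Mapping.keys k \<inter> S \<noteq> {}" for k :: "'v \<Rightarrow>\<^sub>0 nat"
    by auto
  then show ?thesis
    by (simp add: sqfree_ideal_def keys_mult_single_1 keys_add_nat assms)
qed

section \<open>Graded free resolutions\<close>

text \<open>The offset \<open>d\<close> is 0 for differentials and the degree of m for maps lifting
  multiplication by m. The equation is additive to avoid subtraction of natural numbers.\<close>

definition homogeneous_mat ::
    "nat \<Rightarrow> nat list \<Rightarrow> nat list \<Rightarrow> ('v, 'k::comm_ring_1) mpoly mat \<Rightarrow> bool" where
  "homogeneous_mat d R C M \<longleftrightarrow> M \<in> carrier_mat (length R) (length C) \<and>
     (\<forall>l<length R. \<forall>k<length C. \<forall>u\<in>Poly_Mapping.keys (M $$ (l, k)). mono_deg u + R ! l = C ! k + d)"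

lemma homogeneous_mat_carrier:
  "homogeneous_mat d R C M \<Longrightarrow> M \<in> carrier_mat (length R) (length C)"
  by (simp add: homogeneous_mat_def)

lemma homogeneous_mat_deg:
  "homogeneous_mat d R C M \<Longrightarrow> l < length R \<Longrightarrow> k < length C \<Longrightarrow> u \<in> Poly_Mapping.keys (M $$ (l, k)) \<Longrightarrow>
    mono_deg u + R ! l = C ! k + d"
  by (simp add: homogeneous_mat_def)

lemma mult_mat_unit_vec:
  fixes A :: "'r::semiring_1 mat"
  assumes "A \<in> carrier_mat n m" "k < m"
  shows "A *\<^sub>v unit_vec m k = col A k"
  by (rule eq_vecI) (use assms in auto)

lemma mat_factor:
  fixes A :: "'r::comm_ring_1 mat"
  assumes A: "A \<in> carrier_mat n s" and M: "M \<in> carrier_mat n c"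
    and im: "\<And>k. k < c \<Longrightarrow> \<exists>w\<in>carrier_vec s. A *\<^sub>v w = col M k"
  obtains X where "X \<in> carrier_mat s c" "A * X = M"
proof -
  obtain w where w: "\<And>k. k < c \<Longrightarrow> w k \<in> carrier_vec s \<and> A *\<^sub>v w k = col M k"
    using im by metis
  let ?X = "mat s c (\<lambda>(j, k). w k $ j)"
  have col: "col ?X k = w k" if "k < c" for k
    using w[OF that] that by (intro eq_vecI) auto
  have "A * ?X = M"
  proof (rule mat_col_eqI)
    fix k assume "k < dim_col M"
    then have k: "k < c" using M by simp
    have "col (A * ?X) k = A *\<^sub>v col ?X k"
      by (rule col_mult2[OF A _ k]) simp
    then show "col (A * ?X) k = col M k"
      using w[OF k] col[OF k] by simp
  qed (use A M in auto)
  then show ?thesis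
    by (intro that[of ?X]) auto
qed

text \<open>An arbitrary factor exists columnwise; dropping from each of its entries the terms of
  the wrong degree leaves the product unchanged, because \<open>A\<close> and \<open>M\<close> are
  homogeneous.\<close>

lemma homogeneous_mat_factor:
  fixes A M :: "('v, 'k::comm_ring_1) mpoly mat"
  assumes A: "homogeneous_mat 0 R S A" and M: "homogeneous_mat d R C M"
    and im: "\<And>k. k < length C \<Longrightarrow> \<exists>w\<in>carrier_vec (length S). A *\<^sub>v w = col M k"
  obtains X where "homogeneous_mat d S C X" "A * X = M"
proof -
  note cA = homogeneous_mat_carrier[OF A] and cM = homogeneous_mat_carrier[OF M]
  obtain Y where Y: "Y \<in> carrier_mat (length S) (length C)" "A * Y = M"
    using mat_factor[OF cA cM im] by metis
  let ?P = "\<lambda>T l k u. mono_deg u + T ! l = C ! k + d"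
  let ?X = "mat (length S) (length C) (\<lambda>(j, k). filter_poly (?P S j k) (Y $$ (j, k)))"
  have "homogeneous_mat d S C ?X"
    by (auto simp: homogeneous_mat_def keys_filter_poly)
  moreover have "A * ?X = M"
  proof (rule eq_matI)
    fix l k assume "l < dim_row M" "k < dim_col M"
    then have l: "l < length R" and k: "k < length C"
      using cM by auto
    have "(A * ?X) $$ (l, k) = (\<Sum>j<length S. A $$ (l, j) * filter_poly (?P S j k) (Y $$ (j, k)))"
      using l k cA by (simp add: scalar_prod_def lessThan_atLeast0)
    \<comment> \<open>A term p of \<open>A $$ (l, j)\<close> has degree
      \<open>S ! j - R ! l\<close>, so p u has the degree required in row l exactly when u has the
      one required in row j.\<close>
    also have "\<dots> = (\<Sum>j<length S. filter_poly (?P R l k) (A $$ (l, j) * Y $$ (j, k)))"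
    proof (rule sum.cong[OF refl])
      fix j assume "j \<in> {..<length S}"
      then show "A $$ (l, j) * filter_poly (?P S j k) (Y $$ (j, k)) = filter_poly (?P R l k) (A $$ (l, j) * Y $$ (j, k))"
        using homogeneous_mat_deg[OF A l, of j] by (intro filter_poly_mult[symmetric]) (fastforce simp: mono_deg_add)
    qed
    also have "\<dots> = filter_poly (?P R l k) ((A * Y) $$ (l, k))"
      using l k cA Y(1) by (simp add: scalar_prod_def lessThan_atLeast0 filter_poly_sum)
    also have "\<dots> = M $$ (l, k)"
      using homogeneous_mat_deg[OF M l k] by (simp add: Y(2) filter_poly_id)
    finally show "(A * ?X) $$ (l, k) = M $$ (l, k)" .
  qed (use cA cM in auto)
  ultimately show ?thesis
    by (rule that)
qed

locale min_res =
  fixes I :: "('v, 'k::field) mpoly set" and D A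
  assumes res: "minimal_graded_free_resolution I D A"
begin

lemma D0: "D 0 = [0]"
  using res by (simp add: minimal_graded_free_resolution_def)

lemma hom: "homogeneous_mat 0 (D i) (D (Suc i)) (A (Suc i))"
  using res by (simp add: minimal_graded_free_resolution_def homogeneous_mat_def)

lemmas car = homogeneous_mat_carrier[OF hom]

lemma image0: "f \<in> I \<longleftrightarrow> (\<exists>v\<in>carrier_vec (length (D (Suc 0))). f = (A (Suc 0) *\<^sub>v v) $ 0)"
  using res by (auto simp: minimal_graded_free_resolution_def)

lemma exact:
  assumes "v \<in> carrier_vec (length (D (Suc i)))"
  shows "A (Suc i) *\<^sub>v v = 0\<^sub>v (length (D i)) \<longleftrightarrow>
    (\<exists>w\<in>carrier_vec (length (D (Suc (Suc i)))). A (Suc (Suc i)) *\<^sub>v w = v)"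
proof -
  have "mat_kernel (A (Suc i)) = {A (Suc (Suc i)) *\<^sub>v w | w. w \<in> carrier_vec (length (D (Suc (Suc i))))}"
    using res by (auto simp: minimal_graded_free_resolution_def)
  then have "v \<in> mat_kernel (A (Suc i)) \<longleftrightarrow>
      (\<exists>w\<in>carrier_vec (length (D (Suc (Suc i)))). A (Suc (Suc i)) *\<^sub>v w = v)"
    by auto
  then show ?thesis
    using assms by (simp add: mat_kernel[OF car])
qed

lemma minimal:
  assumes "l < length (D i)" "k < length (D (Suc i))"
  shows "Poly_Mapping.lookup (A (Suc i) $$ (l, k)) 0 = 0"
proof -
  have "A (Suc i) $$ (l, k) \<in> elements_mat (A (Suc i))"
    using assms car[of i] by (force simp: elements_mat_def)
  then show ?thesis
    using res by (auto simp: minimal_graded_free_resolution_def irrelevant_ideal_eq)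
qed

lemma mult_zero: "A (Suc i) * A (Suc (Suc i)) = 0\<^sub>m (length (D i)) (length (D (Suc (Suc i))))"
proof (rule mat_col_eqI)
  fix k assume "k < dim_col (0\<^sub>m (length (D i)) (length (D (Suc (Suc i)))))"
  then have k: "k < length (D (Suc (Suc i)))" by simp
  let ?e = "unit_vec (length (D (Suc (Suc i)))) k"
  have "A (Suc (Suc i)) *\<^sub>v ?e = col (A (Suc (Suc i))) k"
    using car[of "Suc i"] k by (rule mult_mat_unit_vec)
  then have "A (Suc i) *\<^sub>v col (A (Suc (Suc i))) k = 0\<^sub>v (length (D i))"
    by (subst exact) (use car[of "Suc i"] k in auto)
  then show "col (A (Suc i) * A (Suc (Suc i))) k = col (0\<^sub>m (length (D i)) (length (D (Suc (Suc i))))) k"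
    using col_mult2[OF car car k] k by simp
qed (use car[of i] car[of "Suc i"] in auto)

text \<open>Exactness in the columnwise form expected by the two factorization lemmas.\<close>

lemma factor_of_mult_zero:
  assumes M: "M \<in> carrier_mat (length (D (Suc i))) c" and 0: "A (Suc i) * M = 0\<^sub>m (length (D i)) c"
    and k: "k < c"
  shows "\<exists>w\<in>carrier_vec (length (D (Suc (Suc i)))). A (Suc (Suc i)) *\<^sub>v w = col M k"
proof -
  have "A (Suc i) *\<^sub>v col M k = col (A (Suc i) * M) k"
    by (rule col_mult2[OF car M k, symmetric])
  then have "A (Suc i) *\<^sub>v col M k = 0\<^sub>v (length (D i))"
    using 0 k by simp
  then show ?thesis
    using carrier_vecI[of "col M k" "length (D (Suc i))"] M by (subst (asm) exact) auto
qed

end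

text \<open>The comparison theorem: multiplication by m maps J' into J, hence induces a map R/J'
  \<rightarrow> R/J, which lifts step by step to the resolutions because free modules are projective
  and the target is exact.\<close>

lemma chain_map_exists:
  assumes F: "min_res J D A" and G: "min_res J' E B"
    and m: "\<And>u. u \<in> Poly_Mapping.keys m \<Longrightarrow> mono_deg u = d"
    and J: "\<And>f. f \<in> J' \<Longrightarrow> f * m \<in> J"
  obtains \<phi> where "\<phi> 0 = mat 1 1 (\<lambda>_. m)"
    "\<And>i. homogeneous_mat d (D i) (E i) (\<phi> i)"
    "\<And>i. A (Suc i) * \<phi> (Suc i) = \<phi> i * B (Suc i)"
proof -
  interpret F: min_res J D A by fact
  interpret G: min_res J' E B by fact
  \<comment> \<open>The last conjunct keeps the recursion going: the columns of
    \<open>X * B (Suc n)\<close> already lie in the image of \<open>A (Suc n)\<close>, so the next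
    matrix can be chosen.\<close>
  define P where "P n X \<longleftrightarrow> homogeneous_mat d (D n) (E n) X \<and> (n = 0 \<longrightarrow> X = mat 1 1 (\<lambda>_. m)) \<and>
    (\<forall>k<length (E (Suc n)). \<exists>w\<in>carrier_vec (length (D (Suc n))). A (Suc n) *\<^sub>v w = col (X * B (Suc n)) k)"
    for n X
  have hom: "homogeneous_mat d (D n) (E (Suc n)) (X * B (Suc n))" if X: "homogeneous_mat d (D n) (E n) X" for n X
    unfolding homogeneous_mat_def
  proof (intro conjI allI impI ballI)
    note cX = homogeneous_mat_carrier[OF X] and cB = G.car[of n]
    show "X * B (Suc n) \<in> carrier_mat (length (D n)) (length (E (Suc n)))"
      using cX cB by simp
    fix l k u
    assume l: "l < length (D n)" and k: "k < length (E (Suc n))" and "u \<in> Poly_Mapping.keys ((X * B (Suc n)) $$ (l, k))"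
    moreover have "(X * B (Suc n)) $$ (l, k) = (\<Sum>j<length (E n). X $$ (l, j) * B (Suc n) $$ (j, k))"
      using l k cX cB by (simp add: scalar_prod_def lessThan_atLeast0)
    ultimately obtain j where j: "j < length (E n)" "u \<in> Poly_Mapping.keys (X $$ (l, j) * B (Suc n) $$ (j, k))"
      using Poly_Mapping.keys_sum[of "\<lambda>j. X $$ (l, j) * B (Suc n) $$ (j, k)" "{..<length (E n)}"] by auto
    then obtain p q where "p \<in> Poly_Mapping.keys (X $$ (l, j))" "q \<in> Poly_Mapping.keys (B (Suc n) $$ (j, k))" "u = p + q"
      using keys_mult[of "X $$ (l, j)" "B (Suc n) $$ (j, k)"] by blast
    then show "mono_deg u + D n ! l = E (Suc n) ! k + d"
      using homogeneous_mat_deg[OF X l j(1)] homogeneous_mat_deg[OF G.hom j(1) k]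
      by (fastforce simp: mono_deg_add)
  qed
  have "\<exists>\<phi>. \<forall>n. P n (\<phi> n) \<and> A (Suc n) * \<phi> (Suc n) = \<phi> n * B (Suc n)"
  proof (rule dependent_nat_choice)
    let ?X = "mat 1 1 (\<lambda>_. m)"
    have "\<exists>w\<in>carrier_vec (length (D (Suc 0))). A (Suc 0) *\<^sub>v w = col (?X * B (Suc 0)) k"
      if k: "k < length (E (Suc 0))" for k
    proof -
      have "B (Suc 0) $$ (0, k) \<in> J'"
        unfolding G.image0 using k G.car[of 0]
        by (intro bexI[of _ "unit_vec (length (E (Suc 0))) k"]) (auto simp: mult_mat_unit_vec[OF G.car[of 0]] G.D0)
      then obtain w where w: "w \<in> carrier_vec (length (D (Suc 0)))" "B (Suc 0) $$ (0, k) * m = (A (Suc 0) *\<^sub>v w) $ 0"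
        using J F.image0 by blast
      have "A (Suc 0) *\<^sub>v w = col (?X * B (Suc 0)) k"
      proof (rule eq_vecI)
        fix l assume "l < dim_vec (col (?X * B (Suc 0)) k)"
        then have "l = 0" by simp
        then show "(A (Suc 0) *\<^sub>v w) $ l = col (?X * B (Suc 0)) k $ l"
          using w(2) k G.car[of 0] by (simp add: G.D0 scalar_prod_def mult.commute)
      qed (use F.car[of 0] F.D0 in auto)
      with w(1) show ?thesis ..
    qed
    moreover have "homogeneous_mat d (D 0) (E 0) ?X"
      using m by (simp add: homogeneous_mat_def F.D0 G.D0)
    ultimately show "\<exists>X. P 0 X"
      unfolding P_def by blast
  next
    fix X n assume "P n X"
    then have X: "homogeneous_mat d (D n) (E n) X"
      "\<And>k. k < length (E (Suc n)) \<Longrightarrow> \<exists>w\<in>carrier_vec (length (D (Suc n))). A (Suc n) *\<^sub>v w = col (X * B (Suc n)) k"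
      by (auto simp: P_def)
    obtain Y where Y: "homogeneous_mat d (D (Suc n)) (E (Suc n)) Y" "A (Suc n) * Y = X * B (Suc n)"
      using homogeneous_mat_factor[OF F.hom hom[OF X(1)] X(2)] by metis
    note cX = homogeneous_mat_carrier[OF X(1)] and cY = homogeneous_mat_carrier[OF Y(1)]
    \<comment> \<open>The invariant is restored: \<open>A\<close> kills the columns of
      \<open>Y * B (Suc (Suc n))\<close>, since two consecutive differentials compose to zero, and
      exactness lifts them.\<close>
    have "A (Suc n) * (Y * B (Suc (Suc n))) = X * (B (Suc n) * B (Suc (Suc n)))"
      unfolding assoc_mult_mat[OF F.car cY G.car, symmetric] Y(2) assoc_mult_mat[OF cX G.car G.car] ..
    also have "\<dots> = 0\<^sub>m (length (D n)) (length (E (Suc (Suc n))))"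
      using cX by (simp add: G.mult_zero)
    finally have "A (Suc n) * (Y * B (Suc (Suc n))) = 0\<^sub>m (length (D n)) (length (E (Suc (Suc n))))" .
    then have "P (Suc n) Y"
      unfolding P_def using Y(1) F.factor_of_mult_zero[OF mult_carrier_mat[OF cY G.car]] by blast
    then show "\<exists>Y. P (Suc n) Y \<and> A (Suc n) * Y = X * B (Suc n)"
      using Y(2) by blast
  qed
  then obtain \<phi> where \<phi>: "\<And>n. P n (\<phi> n)" "\<And>n. A (Suc n) * \<phi> (Suc n) = \<phi> n * B (Suc n)"
    by blast
  show ?thesis
  proof (rule that)
    show "\<phi> 0 = mat 1 1 (\<lambda>_. m)" "homogeneous_mat d (D i) (E i) (\<phi> i)" for i
      using \<phi>(1) by (simp_all add: P_def)
  qed (rule \<phi>(2))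
qed

subsection \<open>Uniqueness of the ranks\<close>

text \<open>Reduction modulo the ideal of the variables, that is, tensoring with the field.\<close>

definition const_mat :: "('v, 'k::field) mpoly mat \<Rightarrow> 'k mat" where
  "const_mat = map_mat (\<lambda>f. Poly_Mapping.lookup f 0)"

lemma const_mat_mult:
  assumes "X \<in> carrier_mat n m" "Y \<in> carrier_mat m k"
  shows "const_mat (X * Y) = const_mat X * const_mat Y"
  by (rule eq_matI)
    (use assms in \<open>auto simp: const_mat_def scalar_prod_def lookup_sum lookup_0_mult\<close>)

text \<open>If m < n, padding with zeros gives square matrices with product 1, so they also commute;
  but row m of the padded \<open>Y\<close> is zero, which contradicts the diagonal entry (m,
  m).\<close>

lemma right_inverse_mat_le:
  fixes X :: "'k::field mat"
  assumes X: "X \<in> carrier_mat n m" and Y: "Y \<in> carrier_mat m n" and 1: "X * Y = 1\<^sub>m n"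
  shows "n \<le> m"
proof (rule ccontr)
  assume "\<not> n \<le> m"
  then have m: "m < n" by simp
  let ?X = "mat n n (\<lambda>(i, j). if j < m then X $$ (i, j) else 0)"
  let ?Y = "mat n n (\<lambda>(i, j). if i < m then Y $$ (i, j) else 0)"
  have "?X * ?Y = X * Y"
  proof (rule eq_matI)
    fix i j assume "i < dim_row (X * Y)" "j < dim_col (X * Y)"
    then have ij: "i < n" "j < n" using X Y by auto
    then have "(?X * ?Y) $$ (i, j) = (\<Sum>k<n. if k < m then X $$ (i, k) * Y $$ (k, j) else 0)"
      by (auto simp: scalar_prod_def lessThan_atLeast0 intro!: sum.cong)
    also have "\<dots> = (\<Sum>k<m. X $$ (i, k) * Y $$ (k, j))"
      by (rule sum.mono_neutral_cong_right) (use m in auto)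
    also have "\<dots> = (X * Y) $$ (i, j)"
      using ij X Y by (simp add: scalar_prod_def lessThan_atLeast0)
    finally show "(?X * ?Y) $$ (i, j) = (X * Y) $$ (i, j)" .
  qed (use X Y in auto)
  then have "?X * ?Y = 1\<^sub>m n"
    using 1 by simp
  then have "?Y * ?X = 1\<^sub>m n"
    by (rule mat_mult_left_right_inverse[OF mat_carrier mat_carrier])
  moreover have "(?Y * ?X) $$ (m, m) = 0"
    using m by (simp add: scalar_prod_def)
  ultimately show False
    using m by simp
qed

text \<open>Both composites of comparison maps are homotopic to the identity, hence equal to it modulo the
  irrelevant ideal.\<close>

lemma min_res_rank_le:
  fixes J :: "('v, 'k::field) mpoly set"
  assumes F: "min_res J D A" and G: "min_res J E B"
  shows "length (D i) \<le> length (E i)"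
proof -
  interpret F: min_res J D A by fact
  interpret G: min_res J E B by fact
  have one: "mono_deg u = 0" if "u \<in> Poly_Mapping.keys (1 :: ('v, 'k) mpoly)" for u
    using that by simp
  have mult1: "f * 1 \<in> J" if "f \<in> J" for f
    using that by simp
  obtain f where f: "f 0 = mat 1 1 (\<lambda>_. 1)" "\<And>i. homogeneous_mat 0 (D i) (E i) (f i)"
    "\<And>i. A (Suc i) * f (Suc i) = f i * B (Suc i)"
    using chain_map_exists[OF F G one mult1] by blast
  obtain g where g: "g 0 = mat 1 1 (\<lambda>_. 1)" "\<And>i. homogeneous_mat 0 (E i) (D i) (g i)"
    "\<And>i. B (Suc i) * g (Suc i) = g i * A (Suc i)"
    using chain_map_exists[OF G F one mult1] by blast
  note cf = homogeneous_mat_carrier[OF f(2)] and cg = homogeneous_mat_carrier[OF g(2)]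
  \<comment> \<open>The error of the composite is a chain map that lifts zero; it will be shown to
    be null-homotopic.\<close>
  define \<rho> where "\<rho> i = f i * g i - 1\<^sub>m (length (D i))" for i
  have c\<rho>: "\<rho> i \<in> carrier_mat (length (D i)) (length (D i))" for i
    unfolding \<rho>_def by (rule minus_carrier_mat) simp
  have A\<rho>: "A (Suc i) * \<rho> (Suc i) = \<rho> i * A (Suc i)" for i
  proof -
    have "A (Suc i) * (f (Suc i) * g (Suc i)) = f i * g i * A (Suc i)"
      unfolding assoc_mult_mat[OF F.car cf cg, symmetric] f(3) assoc_mult_mat[OF cf G.car cg] g(3)
      by (rule assoc_mult_mat[OF cf cg F.car, symmetric])
    then show ?thesis
      unfolding \<rho>_def mult_minus_distrib_mat[OF F.car mult_carrier_mat[OF cf cg] one_carrier_mat]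
        minus_mult_distrib_mat[OF mult_carrier_mat[OF cf cg] one_carrier_mat F.car]
      using F.car[of i] by simp
  qed
  \<comment> \<open>One step of the homotopy. The hypothesis says that \<open>A (Suc i)\<close>
    annihilates \<open>\<rho> (Suc i) - h * A (Suc i)\<close>, so by exactness this matrix factors
    through the next differential, with factor \<open>h'\<close>.\<close>
  have step: "\<exists>h'\<in>carrier_mat (length (D (Suc (Suc i)))) (length (D (Suc i))).
      \<rho> (Suc i) = h * A (Suc i) + A (Suc (Suc i)) * h'"
    if h: "h \<in> carrier_mat (length (D (Suc i))) (length (D i))"
      and 0: "(\<rho> i - A (Suc i) * h) * A (Suc i) = 0\<^sub>m (length (D i)) (length (D (Suc i)))" for i h
  proof -
    let ?M = "\<rho> (Suc i) - h * A (Suc i)"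
    have M: "?M \<in> carrier_mat (length (D (Suc i))) (length (D (Suc i)))"
      by (rule minus_carrier_mat) (rule mult_carrier_mat[OF h F.car])
    have "A (Suc i) * ?M = \<rho> i * A (Suc i) - A (Suc i) * (h * A (Suc i))"
      unfolding mult_minus_distrib_mat[OF F.car c\<rho> mult_carrier_mat[OF h F.car]] A\<rho> ..
    also have "\<dots> = (\<rho> i - A (Suc i) * h) * A (Suc i)"
      unfolding minus_mult_distrib_mat[OF c\<rho> mult_carrier_mat[OF F.car h] F.car]
        assoc_mult_mat[OF F.car h F.car] ..
    finally obtain h' where h': "h' \<in> carrier_mat (length (D (Suc (Suc i)))) (length (D (Suc i)))"
        "A (Suc (Suc i)) * h' = ?M"
      using mat_factor[OF F.car M F.factor_of_mult_zero[OF M]] 0 by metis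
    have "\<rho> (Suc i) = h * A (Suc i) + A (Suc (Suc i)) * h'"
      unfolding h'(2) using h F.car[of i] c\<rho>[of "Suc i"] by (intro eq_matI) auto
    then show ?thesis
      using h'(1) by blast
  qed
  have "\<exists>h\<in>carrier_mat (length (D (Suc i))) (length (D i)).
      (\<rho> i - A (Suc i) * h) * A (Suc i) = 0\<^sub>m (length (D i)) (length (D (Suc i)))" for i
  proof (induction i)
    case 0
    have "\<rho> 0 = 0\<^sub>m 1 1"
      by (rule eq_matI) (auto simp: \<rho>_def f(1) g(1) F.D0 scalar_prod_def)
    then show ?case
      using F.car[of 0] F.D0 by (intro bexI[of _ "0\<^sub>m (length (D (Suc 0))) (length (D 0))"])
          (auto simp: minus_r_inv_mat[of _ "Suc 0" "Suc 0"])
  next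
    case (Suc i)
    then obtain h h' where h: "h \<in> carrier_mat (length (D (Suc i))) (length (D i))"
      "h' \<in> carrier_mat (length (D (Suc (Suc i)))) (length (D (Suc i)))"
      "\<rho> (Suc i) = h * A (Suc i) + A (Suc (Suc i)) * h'"
      using step by blast
    have "(\<rho> (Suc i) - A (Suc (Suc i)) * h') = h * A (Suc i)"
      unfolding h(3) using h(1,2) F.car[of i] F.car[of "Suc i"] by (intro eq_matI) auto
    then have "(\<rho> (Suc i) - A (Suc (Suc i)) * h') * A (Suc (Suc i)) = h * (A (Suc i) * A (Suc (Suc i)))"
      by (simp only: assoc_mult_mat[OF h(1) F.car F.car])
    also have "\<dots> = 0\<^sub>m (length (D (Suc i))) (length (D (Suc (Suc i))))"
      using h(1) by (simp add: F.mult_zero)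
    finally show ?case
      using h(2) by blast
  qed
  then have ex: "\<exists>h h'. h \<in> carrier_mat (length (D (Suc i))) (length (D i)) \<and>
      h' \<in> carrier_mat (length (D (Suc (Suc i)))) (length (D (Suc i))) \<and>
      \<rho> (Suc i) = h * A (Suc i) + A (Suc (Suc i)) * h'" for i
    using step by blast
  \<comment> \<open>In both summands one factor is a differential of a minimal resolution, whose
    entries have no constant term.\<close>
  have \<rho>0: "const_mat (\<rho> (Suc i)) = 0\<^sub>m (length (D (Suc i))) (length (D (Suc i)))" for i
  proof -
    obtain h h' where h: "h \<in> carrier_mat (length (D (Suc i))) (length (D i))"
      "h' \<in> carrier_mat (length (D (Suc (Suc i)))) (length (D (Suc i)))"
      "\<rho> (Suc i) = h * A (Suc i) + A (Suc (Suc i)) * h'"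
      using ex by blast
    show ?thesis
      unfolding h(3) using h(1,2) F.car[of i] F.car[of "Suc i"]
      by (intro eq_matI)
        (auto simp: const_mat_def lookup_add lookup_sum scalar_prod_def lookup_0_mult F.minimal)
  qed
  show ?thesis
  proof (cases i)
    case 0
    then show ?thesis by (simp add: F.D0 G.D0)
  next
    case (Suc j)
    \<comment> \<open>Modulo the variables f g becomes the identity, so its inner dimension, the
      rank in the other resolution, is at least the outer one.\<close>
    have "const_mat (f i) * const_mat (g i) = const_mat (f i * g i)"
      by (rule const_mat_mult[symmetric]) (rule cf cg)+
    also have "f i * g i = \<rho> i + 1\<^sub>m (length (D i))"
      using cf[of i] cg[of i] by (intro eq_matI) (auto simp: \<rho>_def)
    also have "const_mat \<dots> = const_mat (\<rho> i) + 1\<^sub>m (length (D i))"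
      using c\<rho>[of i] by (intro eq_matI) (auto simp: const_mat_def lookup_add)
    finally have "const_mat (f i) * const_mat (g i) = 1\<^sub>m (length (D i))"
      by (simp add: \<rho>0 Suc)
    then show ?thesis
      using cf[of i] cg[of i]
      by (intro right_inverse_mat_le[of "const_mat (f i)" _ _ "const_mat (g i)"]) (auto simp: const_mat_def)
  qed
qed

section \<open>Mapping cones and linear quotients\<close>

lemma homogeneous_mat_four_block:
  assumes A: "homogeneous_mat 0 R C A" and X: "homogeneous_mat d R C' X" and Y: "homogeneous_mat d R' C' Y"
  shows "homogeneous_mat 0 (R @ R') (C @ map (\<lambda>e. e + d) C')
    (four_block_mat A X (0\<^sub>m (length R') (length C)) Y)"
  unfolding homogeneous_mat_def
proof (intro conjI allI impI ballI)
  note car = homogeneous_mat_carrier[OF A] homogeneous_mat_carrier[OF X] homogeneous_mat_carrier[OF Y]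
  let ?M = "four_block_mat A X (0\<^sub>m (length R') (length C)) Y"
  show "?M \<in> carrier_mat (length (R @ R')) (length (C @ map (\<lambda>e. e + d) C'))"
    using car by auto
  fix l k u
  assume lk: "l < length (R @ R')" "k < length (C @ map (\<lambda>e. e + d) C')" and u: "u \<in> Poly_Mapping.keys (?M $$ (l, k))"
  have "?M $$ (l, k) = (if l < length R then if k < length C then A $$ (l, k) else X $$ (l, k - length C)
     else if k < length C then 0 else Y $$ (l - length R, k - length C))"
    using lk car by (auto simp: index_mat_four_block)
  with u lk homogeneous_mat_deg[OF A, of l k u] homogeneous_mat_deg[OF X, of l "k - length C" u]
    homogeneous_mat_deg[OF Y, of "l - length R" "k - length C" u]
  show "mono_deg u + (R @ R') ! l = (C @ map (\<lambda>e. e + d) C') ! k + 0"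
    by (auto simp: nth_append split: if_splits)
qed

lemma minimal_graded_free_resolutionI:
  fixes I :: "('v, 'k::field) mpoly set"
  assumes "D 0 = [0]"
    and hom: "\<And>i. homogeneous_mat 0 (D i) (D (Suc i)) (A (Suc i))"
    and im: "\<And>f. f \<in> I \<longleftrightarrow> (\<exists>v\<in>carrier_vec (length (D (Suc 0))). f = (A (Suc 0) *\<^sub>v v) $ 0)"
    and zero: "\<And>i. A (Suc i) * A (Suc (Suc i)) = 0\<^sub>m (length (D i)) (length (D (Suc (Suc i))))"
    and exact: "\<And>i v. v \<in> carrier_vec (length (D (Suc i))) \<Longrightarrow> A (Suc i) *\<^sub>v v = 0\<^sub>v (length (D i)) \<Longrightarrow>
      \<exists>w\<in>carrier_vec (length (D (Suc (Suc i)))). A (Suc (Suc i)) *\<^sub>v w = v"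
    and min: "\<And>i l k. l < length (D i) \<Longrightarrow> k < length (D (Suc i)) \<Longrightarrow> Poly_Mapping.lookup (A (Suc i) $$ (l, k)) 0 = 0"
  shows "min_res I D A"
proof -
  note car = homogeneous_mat_carrier[OF hom]
  have "mat_kernel (A (Suc i)) = {A (Suc (Suc i)) *\<^sub>v v | v. v \<in> carrier_vec (length (D (Suc (Suc i))))}" for i
  proof (intro equalityI subsetI)
    fix v assume "v \<in> mat_kernel (A (Suc i))"
    then show "v \<in> {A (Suc (Suc i)) *\<^sub>v v | v. v \<in> carrier_vec (length (D (Suc (Suc i))))}"
      using exact[of v i] unfolding mat_kernel[OF car] by blast
  next
    fix v assume "v \<in> {A (Suc (Suc i)) *\<^sub>v v | v. v \<in> carrier_vec (length (D (Suc (Suc i))))}"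
    then obtain w where w: "w \<in> carrier_vec (length (D (Suc (Suc i))))" "v = A (Suc (Suc i)) *\<^sub>v w"
      by blast
    have "A (Suc i) *\<^sub>v v = 0\<^sub>v (length (D i))"
      unfolding w(2) assoc_mult_mat_vec[OF car car w(1), symmetric] zero using w(1) by (intro eq_vecI) auto
    then show "v \<in> mat_kernel (A (Suc i))"
      unfolding mat_kernel[OF car] using w mult_mat_vec_carrier[OF car w(1)] by blast
  qed
  moreover have "elements_mat (A (Suc i)) \<subseteq> ideal_gen (range mpvar)" for i
    using min[of _ i] car[of i] by (auto simp: elements_mat_def irrelevant_ideal_eq)
  ultimately show ?thesis
    unfolding min_res_def minimal_graded_free_resolution_def
    using assms(1) hom im by (auto simp: homogeneous_mat_def)
qed

text \<open>With J' = J : m the sequence 0 \<rightarrow> (R/J')(-d) \<rightarrow> R/J \<rightarrow>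
  R/(J + (m)) \<rightarrow> 0 is exact, its first map being multiplication by m; the cone of a lift
  of that map resolves the last term. The bounds \<open>degD\<close> and \<open>degE\<close> serve
  only minimality.\<close>

lemma mapping_cone:
  fixes J :: "('v, 'k::field) mpoly set"
  assumes F: "min_res J D A" and G: "min_res J' E B"
    and m: "\<And>u. u \<in> Poly_Mapping.keys m \<Longrightarrow> mono_deg u = d" and d: "d \<ge> 1"
    and J': "\<And>f. f \<in> J' \<longleftrightarrow> f * m \<in> J"
    and degD: "\<And>i e. e \<in> set (D (Suc i)) \<Longrightarrow> e \<le> d + i"
    and degE: "\<And>i e. e \<in> set (E i) \<Longrightarrow> i \<le> e"
  shows "\<exists>A'. min_res {f + g * m | f g. f \<in> J}
    (\<lambda>i. D i @ (case i of 0 \<Rightarrow> [] | Suc j \<Rightarrow> map (\<lambda>e. e + d) (E j))) A'"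
proof -
  interpret F: min_res J D A by fact
  interpret G: min_res J' E B by fact
  obtain \<phi> where \<phi>: "\<phi> 0 = mat 1 1 (\<lambda>_. m)"
    "\<And>i. homogeneous_mat d (D i) (E i) (\<phi> i)"
    "\<And>i. A (Suc i) * \<phi> (Suc i) = \<phi> i * B (Suc i)"
    using chain_map_exists[OF F G m] J' by blast
  note c\<phi> = homogeneous_mat_carrier[OF \<phi>(2)]
  define E' where "E' i = (case i of 0 \<Rightarrow> [] | Suc j \<Rightarrow> map (\<lambda>e. e + d) (E j))" for i
  \<comment> \<open>The sign makes the mixed block
    \<open>A (Suc i) * \<phi> (Suc i) + \<phi> i * C (Suc i)\<close> of consecutive differentials
    cancel. For i = 0 the block has no rows, as \<open>E' 0\<close> is empty.\<close>
  define C where "C i = (case i of 0 \<Rightarrow> 0\<^sub>m 0 (length (E 0)) | Suc j \<Rightarrow> - B (Suc j))" for i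
  define Z where "Z i = (0\<^sub>m (length (E' i)) (length (D (Suc i))) :: ('v, 'k) mpoly mat)" for i
  define A' where "A' i = (case i of 0 \<Rightarrow> 0\<^sub>m 0 0 | Suc j \<Rightarrow> four_block_mat (A (Suc j)) (\<phi> j) (Z j) (C j))" for i
  have E'S: "E' (Suc i) = map (\<lambda>e. e + d) (E i)" for i
    by (simp add: E'_def)
  have A'S: "A' (Suc i) = four_block_mat (A (Suc i)) (\<phi> i) (Z i) (C i)" for i
    by (simp add: A'_def)
  have homC: "homogeneous_mat d (E' i) (E i) (C i)" for i
  proof (cases i)
    case 0
    then show ?thesis by (simp add: homogeneous_mat_def E'_def C_def)
  next
    case (Suc j)
    then show ?thesis
      using G.hom[of j] G.car[of j] by (auto simp: homogeneous_mat_def E'_def C_def)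
  qed
  note cC = homogeneous_mat_carrier[OF homC]
  have cC': "C i \<in> carrier_mat (length (E' i)) (length (E' (Suc i)))" for i
    using cC[of i] by (simp add: E'S)
  have c\<phi>': "\<phi> i \<in> carrier_mat (length (D i)) (length (E' (Suc i)))" for i
    using c\<phi>[of i] by (simp add: E'S)
  have cZ: "Z i \<in> carrier_mat (length (E' i)) (length (D (Suc i)))" for i
    by (simp add: Z_def)
  have CB: "C i * B (Suc i) = 0\<^sub>m (length (E' i)) (length (E (Suc i)))" for i
  proof (cases i)
    case 0
    then show ?thesis using G.car[of 0] by (intro eq_matI) (auto simp: C_def E'_def)
  next
    case (Suc j)
    then have "C i * B (Suc i) = - (B (Suc j) * B (Suc (Suc j)))"
      using G.car[of j] G.car[of "Suc j"] by (simp add: C_def)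
    also have "\<dots> = 0\<^sub>m (length (E' i)) (length (E (Suc i)))"
      unfolding G.mult_zero by (intro eq_matI) (auto simp: Suc E'_def)
    finally show ?thesis .
  qed
  have split: "\<exists>u\<in>carrier_vec (length (D i)). \<exists>w\<in>carrier_vec (length (E' i)). v = u @\<^sub>v w"
    if "v \<in> carrier_vec (length (D i @ E' i))" for v :: "('v, 'k) mpoly vec" and i
    using that by (intro bexI[of _ "vec_first v (length (D i))"] bexI[of _ "vec_last v (length (E' i))"]) auto
  have app: "A' (Suc i) *\<^sub>v (u @\<^sub>v w) = (A (Suc i) *\<^sub>v u + \<phi> i *\<^sub>v w) @\<^sub>v (C i *\<^sub>v w)"
    if "u \<in> carrier_vec (length (D (Suc i)))" "w \<in> carrier_vec (length (E' (Suc i)))" for i u w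
  proof -
    have "Z i *\<^sub>v u + C i *\<^sub>v w = C i *\<^sub>v w"
      using that cC'[of i] by (intro eq_vecI) (auto simp: Z_def)
    then show ?thesis
      unfolding A'S using four_block_mat_mult_vec[OF F.car c\<phi>' cZ cC' that] by simp
  qed
  have "min_res {f + g * m | f g. f \<in> J} (\<lambda>i. D i @ E' i) A'"
  proof (rule minimal_graded_free_resolutionI)
    show "D 0 @ E' 0 = [0]"
      by (simp add: F.D0 E'_def)
    show "homogeneous_mat 0 (D i @ E' i) (D (Suc i) @ E' (Suc i)) (A' (Suc i))" for i
      unfolding A'S E'S Z_def by (rule homogeneous_mat_four_block[OF F.hom \<phi>(2) homC])
    show "f \<in> {f + g * m | f g. f \<in> J} \<longleftrightarrow>
        (\<exists>v\<in>carrier_vec (length (D (Suc 0) @ E' (Suc 0))). f = (A' (Suc 0) *\<^sub>v v) $ 0)" for f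
    proof -
      have val: "(A' (Suc 0) *\<^sub>v (u @\<^sub>v w)) $ 0 = (A (Suc 0) *\<^sub>v u) $ 0 + w $ 0 * m"
        if "u \<in> carrier_vec (length (D (Suc 0)))" "w \<in> carrier_vec (length (E' (Suc 0)))" for u w
        unfolding app[OF that] using that F.car[of 0] cC[of 0]
        by (simp add: \<phi>(1) F.D0 G.D0 E'S scalar_prod_def mult.commute)
      show ?thesis
      proof
        assume "f \<in> {f + g * m | f g. f \<in> J}"
        then obtain f' g where f': "f' \<in> J" "f = f' + g * m"
          by blast
        then obtain u where u: "u \<in> carrier_vec (length (D (Suc 0)))" "f' = (A (Suc 0) *\<^sub>v u) $ 0"
          unfolding F.image0 by blast
        have g: "vec 1 (\<lambda>_. g) \<in> carrier_vec (length (E' (Suc 0)))"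
          by (simp add: E'S G.D0)
        have "f = (A' (Suc 0) *\<^sub>v (u @\<^sub>v vec 1 (\<lambda>_. g))) $ 0"
          unfolding f'(2) u(2) val[OF u(1) g] by simp
        moreover have "u @\<^sub>v vec 1 (\<lambda>_. g) \<in> carrier_vec (length (D (Suc 0) @ E' (Suc 0)))"
          unfolding length_append by (rule append_carrier_vec[OF u(1) g])
        ultimately show "\<exists>v\<in>carrier_vec (length (D (Suc 0) @ E' (Suc 0))). f = (A' (Suc 0) *\<^sub>v v) $ 0"
          by blast
      next
        assume "\<exists>v\<in>carrier_vec (length (D (Suc 0) @ E' (Suc 0))). f = (A' (Suc 0) *\<^sub>v v) $ 0"
        then obtain u w where uw: "u \<in> carrier_vec (length (D (Suc 0)))" "w \<in> carrier_vec (length (E' (Suc 0)))"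
          "f = (A' (Suc 0) *\<^sub>v (u @\<^sub>v w)) $ 0"
          using split by blast
        then show "f \<in> {f + g * m | f g. f \<in> J}"
          unfolding uw(3) val[OF uw(1,2)] using F.image0 by blast
      qed
    qed
    show "A' (Suc i) * A' (Suc (Suc i)) = 0\<^sub>m (length (D i @ E' i)) (length (D (Suc (Suc i)) @ E' (Suc (Suc i))))" for i
    proof -
      have CS: "C (Suc i) = - B (Suc i)"
        by (simp add: C_def)
      have 1: "A (Suc i) * A (Suc (Suc i)) + \<phi> i * Z (Suc i) = 0\<^sub>m (length (D i)) (length (D (Suc (Suc i))))"
        unfolding F.mult_zero using c\<phi>[of i] by (intro eq_matI) (auto simp: Z_def E'S)
      have "\<phi> i * C (Suc i) = - (\<phi> i * B (Suc i))"
        unfolding CS using c\<phi>[of i] G.car[of i] by simp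
      then have 2: "A (Suc i) * \<phi> (Suc i) + \<phi> i * C (Suc i) = 0\<^sub>m (length (D i)) (length (E' (Suc (Suc i))))"
        unfolding \<phi>(3) using c\<phi>[of i] G.car[of i] by (intro eq_matI) (auto simp: E'S)
      have 3: "Z i * A (Suc (Suc i)) + C i * Z (Suc i) = 0\<^sub>m (length (E' i)) (length (D (Suc (Suc i))))"
        using F.car[of "Suc i"] cC'[of i] by (intro eq_matI) (auto simp: Z_def)
      have "C i * C (Suc i) = - (C i * B (Suc i))"
        unfolding CS using cC[of i] G.car[of i] by simp
      then have 4: "Z i * \<phi> (Suc i) + C i * C (Suc i) = 0\<^sub>m (length (E' i)) (length (E' (Suc (Suc i))))"
        unfolding CB using c\<phi>[of "Suc i"] by (intro eq_matI) (auto simp: Z_def E'S)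
      show ?thesis
        unfolding A'S mult_four_block_mat[OF F.car c\<phi>' cZ cC' F.car c\<phi>' cZ cC'] 1 2 3 4
        by (intro eq_matI) auto
    qed
    show "\<exists>v'\<in>carrier_vec (length (D (Suc (Suc i)) @ E' (Suc (Suc i)))). A' (Suc (Suc i)) *\<^sub>v v' = v"
      if v: "v \<in> carrier_vec (length (D (Suc i) @ E' (Suc i)))"
        and Av: "A' (Suc i) *\<^sub>v v = 0\<^sub>v (length (D i @ E' i))" for i v
    proof -
      obtain u w where u: "u \<in> carrier_vec (length (D (Suc i)))" and w: "w \<in> carrier_vec (length (E' (Suc i)))"
        and uw: "v = u @\<^sub>v w"
        using split[OF v] by blast
      have w': "w \<in> carrier_vec (length (E i))"
        using w by (simp add: E'S)
      have "(A (Suc i) *\<^sub>v u + \<phi> i *\<^sub>v w) @\<^sub>v (C i *\<^sub>v w) = 0\<^sub>v (length (D i)) @\<^sub>v 0\<^sub>v (length (E' i))"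
        using Av unfolding uw app[OF u w] by (auto intro!: eq_vecI)
      then have 1: "A (Suc i) *\<^sub>v u + \<phi> i *\<^sub>v w = 0\<^sub>v (length (D i))" and 2: "C i *\<^sub>v w = 0\<^sub>v (length (E' i))"
        using F.car[of i] c\<phi>[of i] u w' by (subst (asm) append_vec_eq[of _ "length (D i)"]; auto)+
      \<comment> \<open>For i > 0 this is exactness of the second resolution. For i = 0 the kernel
        condition gives w m \<in> J, hence w \<in> J', which is where the colon hypothesis
        enters.\<close>
      obtain z where z: "z \<in> carrier_vec (length (E (Suc i)))" "B (Suc i) *\<^sub>v z = w"
      proof (cases i)
        case 0
        have "(A (Suc 0) *\<^sub>v u) $ 0 + w $ 0 * m = 0"
          using arg_cong[OF 1, of "\<lambda>x. x $ 0"] w' F.car[of 0]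
          by (simp add: 0 \<phi>(1) F.D0 G.D0 scalar_prod_def mult.commute)
        then have "w $ 0 * m = (A (Suc 0) *\<^sub>v (- u)) $ 0"
          using u F.car[of 0] by (simp add: 0 F.D0 eq_neg_iff_add_eq_0 add.commute)
        then have "w $ 0 \<in> J'"
          unfolding J' F.image0 using u by (intro bexI[of _ "- u"]) (auto simp: 0)
        then obtain z where z: "z \<in> carrier_vec (length (E (Suc 0)))" "w $ 0 = (B (Suc 0) *\<^sub>v z) $ 0"
          unfolding G.image0 by blast
        have "B (Suc 0) *\<^sub>v z = w"
          using w' z(2) G.car[of 0] by (intro eq_vecI) (auto simp: 0 G.D0)
        with z(1) show ?thesis
          using that 0 by blast
      next
        case (Suc j)
        have "- (B (Suc j) *\<^sub>v w) = 0\<^sub>v (length (E j))"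
          using 2 w' G.car[of j] by (simp add: Suc C_def E'_def)
        then have "B (Suc j) *\<^sub>v w = 0\<^sub>v (length (E j))"
          by (metis uminus_uminus_vec uminus_zero_vec)
        then show ?thesis
          using G.exact[of w j] w' that unfolding Suc by blast
      qed
      \<comment> \<open>Adding \<open>\<phi> (Suc i) *\<^sub>v z\<close> corrects u to a cycle of
        the first resolution; a preimage y of it together with -z is the required preimage of
        v.\<close>
      have "A (Suc i) *\<^sub>v (u + \<phi> (Suc i) *\<^sub>v z) = 0\<^sub>v (length (D i))"
        unfolding mult_add_distrib_mat_vec[OF F.car u mult_mat_vec_carrier[OF c\<phi> z(1)]]
          assoc_mult_mat_vec[OF F.car c\<phi> z(1), symmetric] \<phi>(3) assoc_mult_mat_vec[OF c\<phi> G.car z(1)] z(2) 1 ..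
      then obtain y where y: "y \<in> carrier_vec (length (D (Suc (Suc i))))" "A (Suc (Suc i)) *\<^sub>v y = u + \<phi> (Suc i) *\<^sub>v z"
        using F.exact[of "u + \<phi> (Suc i) *\<^sub>v z" i] u mult_mat_vec_carrier[OF c\<phi> z(1)] by auto
      have z': "- z \<in> carrier_vec (length (E' (Suc (Suc i))))"
        using z(1) by (simp add: E'S)
      have "A (Suc (Suc i)) *\<^sub>v y + \<phi> (Suc i) *\<^sub>v (- z) = u"
        unfolding y(2) using u z(1) c\<phi>[of "Suc i"] by (intro eq_vecI) auto
      moreover have "C (Suc i) *\<^sub>v (- z) = w"
        using z w' G.car[of i] by (intro eq_vecI) (auto simp: C_def)
      ultimately have "A' (Suc (Suc i)) *\<^sub>v (y @\<^sub>v - z) = v"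
        unfolding app[OF y(1) z'] uw by simp
      moreover have "y @\<^sub>v - z \<in> carrier_vec (length (D (Suc (Suc i)) @ E' (Suc (Suc i))))"
        using y(1) z' by simp
      ultimately show ?thesis
        by blast
    qed
    show "Poly_Mapping.lookup (A' (Suc i) $$ (l, k)) 0 = 0"
      if lk: "l < length (D i @ E' i)" "k < length (D (Suc i) @ E' (Suc i))" for i l k
    proof -
      have entry: "A' (Suc i) $$ (l, k) = (if l < length (D i) then if k < length (D (Suc i))
          then A (Suc i) $$ (l, k) else \<phi> i $$ (l, k - length (D (Suc i)))
          else if k < length (D (Suc i)) then 0 else C i $$ (l - length (D i), k - length (D (Suc i))))"
        using lk F.car[of i] c\<phi>'[of i] cC'[of i] by (auto simp: A'S Z_def)
      \<comment> \<open>A constant term would force \<open>D i ! l = E i ! k' + d\<close>. But the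
        left side is 0 < d for i = 0 and at most d + i - 1 otherwise, while the right side is at
        least d + i.\<close>
      have "Poly_Mapping.lookup (\<phi> i $$ (l, k')) 0 = 0" if "l < length (D i)" "k' < length (E i)" for k'
      proof (rule ccontr)
        assume "Poly_Mapping.lookup (\<phi> i $$ (l, k')) 0 \<noteq> 0"
        then have eq: "D i ! l = E i ! k' + d"
          using homogeneous_mat_deg[OF \<phi>(2) that, of 0] by (simp add: in_keys_iff)
        show False
        proof (cases i)
          case 0
          then show False using eq that d by (simp add: F.D0)
        next
          case (Suc j)
          then have "D i ! l \<le> d + j" "i \<le> E i ! k'"
            using that degD[of "D i ! l" j] degE[of "E i ! k'" i] by auto
          then show False
            using eq Suc by simp
        qed
      qed
      moreover have "Poly_Mapping.lookup (C i $$ (l', k')) 0 = 0" if "l' < length (E' i)" "k' < length (E i)" for l' k'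
      proof (cases i)
        case 0
        then show ?thesis using that by (simp add: E'_def)
      next
        case (Suc j)
        then show ?thesis
          using that G.minimal[of l' j k'] G.car[of j] by (simp add: E'_def C_def)
      qed
      ultimately show ?thesis
        using lk F.minimal[of l i k] by (auto simp: entry E'S)
    qed
  qed
  then show ?thesis
    unfolding E'_def by blast
qed

section \<open>Koszul complexes and linear quotients\<close>

lemma min_res_zero:
  "min_res (sqfree_ideal {} :: ('v, 'k::field) mpoly set)
    (\<lambda>i. if i = 0 then [0] else []) (\<lambda>i. 0\<^sub>m (if i = 1 then 1 else 0) (if i = 0 then 1 else 0))"
proof (rule minimal_graded_free_resolutionI)
  fix f :: "('v, 'k) mpoly"
  have "f \<in> sqfree_ideal {} \<longleftrightarrow> f = 0"
    by (auto simp: sqfree_ideal_def intro!: poly_mapping_eqI)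
  then show "f \<in> sqfree_ideal {} \<longleftrightarrow> (\<exists>v\<in>carrier_vec (length (if Suc 0 = 0 then [0] else [])).
      f = ((0\<^sub>m (if Suc 0 = 1 then 1 else 0) (if Suc 0 = 0 then 1 else 0)) *\<^sub>v v) $ 0)"
    by (auto simp: scalar_prod_def intro!: exI[of _ "0\<^sub>v 0"])
next
  fix i and v :: "('v, 'k) mpoly vec"
  assume "v \<in> carrier_vec (length (if Suc i = 0 then [0::nat] else []))"
  then show "\<exists>w\<in>carrier_vec (length (if Suc (Suc i) = 0 then [0::nat] else [])).
      0\<^sub>m (if Suc (Suc i) = 1 then 1 else 0) (if Suc (Suc i) = 0 then 1 else 0) *\<^sub>v w = v"
    by (intro bexI[of _ "0\<^sub>v 0"]) auto
qed (auto simp: homogeneous_mat_def)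

text \<open>The Koszul complex, as an iterated mapping cone of multiplication by the variables.\<close>

lemma min_res_variables:
  fixes S :: "'v::finite set"
  shows "\<exists>D A. min_res (sqfree_ideal ((\<lambda>x. {x}) ` S) :: ('v, 'k::field) mpoly set) D A \<and>
    (\<forall>i. length (D i) = card S choose i \<and> (\<forall>e\<in>set (D i). e = i))"
  using finite[of S]
proof (induction S rule: finite_induct)
  case empty
  show ?case
    unfolding image_empty by (intro exI conjI, rule min_res_zero) auto
next
  case (insert x S)
  let ?J = "sqfree_ideal ((\<lambda>x. {x}) ` S) :: ('v, 'k) mpoly set"
  obtain D A where D: "min_res ?J D A" "\<And>i. length (D i) = card S choose i" "\<And>i e. e \<in> set (D i) \<Longrightarrow> e = i"
    using insert.IH by blast
  let ?m = "Poly_Mapping.single (sqfree_mono {x}) (1::'k)"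
  let ?D = "\<lambda>i. D i @ (case i of 0 \<Rightarrow> [] | Suc j \<Rightarrow> map (\<lambda>e. e + 1) (D j))"
  \<comment> \<open>A new variable is a nonzerodivisor modulo the old ones, so the colon ideal is
    the ideal itself and the complex is coned with a shifted copy of itself; Pascal's rule then
    counts the ranks.\<close>
  have colon: "f \<in> ?J \<longleftrightarrow> f * ?m \<in> ?J" for f
    by (rule sqfree_ideal_colon[symmetric]) (use insert.hyps in auto)
  have "\<exists>A'. min_res {f + g * ?m | f g. f \<in> ?J} ?D A'"
    by (rule mapping_cone[OF D(1) D(1)]) (use colon D(3) in fastforce)+
  then have "\<exists>A'. min_res (sqfree_ideal ((\<lambda>x. {x}) ` insert x S) :: ('v, 'k) mpoly set) ?D A'"
    by (simp only: sqfree_ideal_insert image_insert)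
  moreover have "length (?D i) = card (insert x S) choose i" for i
    using insert.hyps D(2) by (cases i) auto
  moreover have "e = i" if "e \<in> set (?D i)" for i e
    using that D(3) by (cases i) auto
  ultimately show ?case
    by blast
qed

text \<open>Each new generator \<open>V b\<close> has a colon ideal generated by the variables
  \<open>S b\<close>, so its cone adds a shifted Koszul complex and contributes
  \<open>card (S b) choose i\<close> in step i + 1. The monotone degrees supply the bound that keeps
  the cones minimal.\<close>

lemma min_res_linear_quotients:
  fixes V S :: "'i::linorder \<Rightarrow> 'v::finite set"
  assumes fin: "finite X" and V: "\<And>b. b \<in> X \<Longrightarrow> V b \<noteq> {}"
    and mono: "\<And>a b. a \<in> X \<Longrightarrow> b \<in> X \<Longrightarrow> a < b \<Longrightarrow> card (V a) \<le> card (V b)"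
    and colon: "\<And>b T. b \<in> X \<Longrightarrow> (\<exists>a\<in>X. a < b \<and> V a \<subseteq> T \<union> V b) \<longleftrightarrow> T \<inter> S b \<noteq> {}"
  shows "\<exists>D A. min_res (sqfree_ideal (V ` X) :: ('v, 'k::field) mpoly set) D A \<and>
    (\<forall>i. length (D (Suc i)) = (\<Sum>b\<in>X. card (S b) choose i))"
proof -
  \<comment> \<open>The induction runs over initial segments, so that Y is exactly the set of
    indices below the next one. The shifts are tracked because the degree bound of the cone refers
    to them.\<close>
  have "\<exists>D A. min_res (sqfree_ideal (V ` Y) :: ('v, 'k::field) mpoly set) D A \<and>
      (\<forall>i. length (D (Suc i)) = (\<Sum>b\<in>Y. card (S b) choose i) \<and>
        (\<forall>e\<in>set (D (Suc i)). \<exists>a\<in>Y. e = card (V a) + i))"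
    if "finite Y" "Y \<subseteq> X" "\<And>a b. b \<in> Y \<Longrightarrow> a \<in> X \<Longrightarrow> a < b \<Longrightarrow> a \<in> Y" for Y
    using that
  proof (induction Y rule: finite_linorder_max_induct)
    case empty
    show ?case
      unfolding image_empty by (intro exI conjI, rule min_res_zero) auto
  next
    case (insert b Y)
    have Y: "Y = {a \<in> X. a < b}"
      using insert.hyps(2) insert.prems by auto
    let ?J = "sqfree_ideal (V ` Y) :: ('v, 'k) mpoly set" and ?K = "sqfree_ideal ((\<lambda>x. {x}) ` S b) :: ('v, 'k) mpoly set"
    obtain D A where D: "min_res ?J D A" "\<And>i. length (D (Suc i)) = (\<Sum>b\<in>Y. card (S b) choose i)"
      "\<And>i e. e \<in> set (D (Suc i)) \<Longrightarrow> \<exists>a\<in>Y. e = card (V a) + i"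
      using insert.IH insert.prems insert.hyps(2) by (metis insert_iff insert_subset less_asym)
    obtain E B where E: "min_res ?K E B" "\<And>i. length (E i) = card (S b) choose i" "\<And>i e. e \<in> set (E i) \<Longrightarrow> e = i"
      using min_res_variables by blast
    let ?m = "Poly_Mapping.single (sqfree_mono (V b)) (1::'k)"
    let ?D = "\<lambda>i. D i @ (case i of 0 \<Rightarrow> [] | Suc j \<Rightarrow> map (\<lambda>e. e + card (V b)) (E j))"
    have b: "b \<in> X" using insert.prems by auto
    have cone: "\<exists>A'. min_res {f + g * ?m | f g. f \<in> ?J} ?D A'"
    proof (rule mapping_cone[OF D(1) E(1)])
      show "1 \<le> card (V b)"
        using V[OF b] by (simp add: Suc_leI card_gt_0_iff)
      have "(\<exists>W\<in>V ` Y. W \<subseteq> T \<union> V b) \<longleftrightarrow> T \<inter> S b \<noteq> {}" for T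
        using colon[OF b, of T] by (auto simp: Y)
      then show "f \<in> ?K \<longleftrightarrow> f * ?m \<in> ?J" for f
        by (rule sqfree_ideal_colon[symmetric])
      show "e \<le> card (V b) + i" if "e \<in> set (D (Suc i))" for i e
        using D(3)[OF that] mono b by (auto simp: Y)
      show "i \<le> e" if "e \<in> set (E i)" for i e
        using E(3)[OF that] by simp
    qed (simp split: if_splits)
    then have "\<exists>A'. min_res (sqfree_ideal (V ` insert b Y) :: ('v, 'k) mpoly set) ?D A'"
      by (simp only: sqfree_ideal_insert image_insert)
    moreover have "length (?D (Suc i)) = (\<Sum>b\<in>insert b Y. card (S b) choose i)" for i
      using insert.hyps D(2) E(2) by (subst sum.insert) auto
    moreover have "\<exists>a\<in>insert b Y. e = card (V a) + i" if "e \<in> set (?D (Suc i))" for i e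
      using that D(3)[of e i] E(3)[of _ i] by auto
    ultimately show ?case
      by blast
  qed
  from this[OF fin] show ?thesis
    by blast
qed

section \<open>The initial ideal of the crystal lattice\<close>

lemma UNIV_crystal: "(UNIV :: ('a, 'b) crystal set) = insert Cs (insert Ct (range Cx1 \<union> range Cx2))"
proof (rule UNIV_eq_I)
  show "x \<in> insert Cs (insert Ct (range Cx1 \<union> range Cx2))" for x :: "('a, 'b) crystal"
    by (cases x) auto
qed

lemma mpvar_mult_sqfree_mono:
  "x \<notin> V \<Longrightarrow> mpvar x * Poly_Mapping.single (sqfree_mono V) (1::'k::comm_ring_1) =
    Poly_Mapping.single (sqfree_mono (insert x V)) 1"
proof -
  assume "x \<notin> V"
  then have "Poly_Mapping.single x 1 + sqfree_mono V = sqfree_mono (insert x V)"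
    by (intro poly_mapping_eqI) (auto simp: lookup_add lookup_single lookup_sqfree_mono when_def)
  then show ?thesis
    by (simp add: mpvar_def mult_single)
qed

lemma mpvar_eq_sqfree_mono: "mpvar x = Poly_Mapping.single (sqfree_mono {x}) (1::'k::comm_ring_1)"
proof -
  have "Poly_Mapping.single x 1 = sqfree_mono {x}"
    by (intro poly_mapping_eqI) (auto simp: lookup_single lookup_sqfree_mono when_def)
  then show ?thesis
    by (simp add: mpvar_def)
qed

section \<open>The generators are leading monomials\<close>

definition crystal_gens :: "('a::{finite,linorder}, 'b::{finite,linorder}) crystal set set" where
  "crystal_gens = {{Cx1 r, Cx2 q} | r q. True} \<union> {{Cs, Ct, Cx1 r} | r. Min UNIV < r} \<union>
     {{Cs, Ct, Cx2 q} | q. Min UNIV < q}"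

lemma leading_monomial_binomial:
  fixes u v :: "'v \<Rightarrow>\<^sub>0 nat"
  assumes "u \<noteq> v" "mless u v"
  shows "Poly_Mapping.single v (1::'k::field) - Poly_Mapping.single u 1 \<noteq> 0 \<and>
    is_leading_monomial mless (Poly_Mapping.single v (1::'k) - Poly_Mapping.single u 1) v"
proof -
  let ?f = "Poly_Mapping.single v (1::'k) - Poly_Mapping.single u 1"
  have v: "v \<in> Poly_Mapping.keys ?f"
    using assms(1) by (simp add: in_keys_iff lookup_minus lookup_single)
  moreover have "Poly_Mapping.keys ?f \<subseteq> {u, v}"
    by (auto simp: in_keys_iff lookup_minus lookup_single when_def split: if_splits)
  ultimately show ?thesis
    using assms(2) unfolding is_leading_monomial_def by fastforce
qed

text \<open>Each generator leads an explicit binomial of the ideal. The cubic ones arise from two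
  quadratic relations sharing a factor y, by cancelling x y z.\<close>

lemma crystal_gens_initial:
  fixes W :: "('a::{finite,linorder}, 'b::{finite,linorder}) crystal set"
  assumes "W \<in> crystal_gens"
  shows "\<exists>f\<in>(join_meet_ideal :: (('a, 'b) crystal, 'k::field) mpoly set). f \<noteq> 0 \<and>
    is_leading_monomial (revlex_less crystal_var_less) f (sqfree_mono W)"
proof -
  let ?I = "join_meet_ideal :: (('a, 'b) crystal, 'k) mpoly set"
  let ?S = "\<lambda>W :: ('a, 'b) crystal set. Poly_Mapping.single (sqfree_mono W) (1::'k)"
  let ?a = "Min UNIV :: 'a" and ?b = "Min UNIV :: 'b"
  have min: "\<not> r < ?a" "\<not> q < ?b" for r q
    using Min_le[OF finite UNIV_I] by (simp_all only: not_less)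
  have gen: "mpvar (Cx1 r) * mpvar (Cx2 q) - mpvar Ct * mpvar Cs \<in> ?I" for r q
    unfolding join_meet_ideal_def by (rule ideal_gen_base, rule CollectI, rule exI[of _ "Cx1 r"], rule exI[of _ "Cx2 q"]) simp
  have gen': "mpvar (Cx2 q) * mpvar (Cx1 r) - mpvar Ct * mpvar Cs \<in> ?I" for r q
    using gen[of r q] by (simp only: mult.commute)
  have g1: "?S {Cx1 r, Cx2 q} - ?S {Cs, Ct} \<in> ?I" for r q
    using gen[of r q]
    by (simp add: mpvar_eq_sqfree_mono[of "Cx2 q"] mpvar_eq_sqfree_mono[of Cs] mpvar_mult_sqfree_mono insert_commute)
  \<comment> \<open>For x = x_{1,r}, z = x_{1,1}, y = x_{2,1} the result is s t x_{1,r} - s t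
    x_{1,1}; the second chain is symmetric.\<close>
  have comb: "mpvar z * (mpvar x * mpvar y - mpvar Ct * mpvar Cs) - mpvar x * (mpvar z * mpvar y - mpvar Ct * mpvar Cs) =
      ?S {Cs, Ct, x} - ?S {Cs, Ct, z}" if "x \<notin> {Cs, Ct}" "z \<notin> {Cs, Ct}" for x y z
  proof -
    have "?S {Cs, Ct, x} = mpvar x * (mpvar Ct * mpvar Cs)" if "x \<notin> {Cs, Ct}" for x
      using that by (simp add: mpvar_eq_sqfree_mono[of Cs] mpvar_mult_sqfree_mono insert_commute)
    with that show ?thesis
      by (simp add: algebra_simps)
  qed
  have g2: "?S {Cs, Ct, Cx1 r} - ?S {Cs, Ct, Cx1 ?a} \<in> ?I" for r
  proof -
    have "mpvar (Cx1 ?a) * (mpvar (Cx1 r) * mpvar (Cx2 ?b) - mpvar Ct * mpvar Cs) -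
        mpvar (Cx1 r) * (mpvar (Cx1 ?a) * mpvar (Cx2 ?b) - mpvar Ct * mpvar Cs) \<in> ?I"
      unfolding join_meet_ideal_def
      by (intro ideal_gen_diff ideal_gen_mult[OF gen[unfolded join_meet_ideal_def]])
    then show ?thesis
      by (subst (asm) comb) auto
  qed
  have g3: "?S {Cs, Ct, Cx2 q} - ?S {Cs, Ct, Cx2 ?b} \<in> ?I" for q
  proof -
    have "mpvar (Cx2 ?b) * (mpvar (Cx2 q) * mpvar (Cx1 ?a) - mpvar Ct * mpvar Cs) -
        mpvar (Cx2 q) * (mpvar (Cx2 ?b) * mpvar (Cx1 ?a) - mpvar Ct * mpvar Cs) \<in> ?I"
      unfolding join_meet_ideal_def
      by (intro ideal_gen_diff ideal_gen_mult[OF gen'[unfolded join_meet_ideal_def]])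
    then show ?thesis
      by (subst (asm) comb) auto
  qed
  \<comment> \<open>At equal degree, the monomial containing the smallest variable x on which the
    two differ is the smaller one, so W leads.\<close>
  have lead: ?thesis if "?S W - ?S U \<in> ?I" "card U = card W" "x \<in> U" "x \<notin> W"
    "\<And>y. crystal_var_less y x \<Longrightarrow> y \<in> U \<longleftrightarrow> y \<in> W" for U x
  proof -
    have "sqfree_mono U \<noteq> sqfree_mono W"
      using that(3,4) by (metis keys_sqfree_mono)
    moreover have "revlex_less crystal_var_less (sqfree_mono U) (sqfree_mono W)"
      unfolding revlex_less_def
      using that by (intro disjI2 conjI exI[of _ x]) (auto simp: lookup_sqfree_mono)
    ultimately show ?thesis
      using leading_monomial_binomial that(1) by blast
  qed
  from assms consider r q where "W = {Cx1 r, Cx2 q}" | r where "?a < r" "W = {Cs, Ct, Cx1 r}"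
    | q where "?b < q" "W = {Cs, Ct, Cx2 q}"
    unfolding crystal_gens_def by blast
  then show ?thesis
  proof cases
    case 1
    then show ?thesis
      using g1 by (intro lead[of "{Cs, Ct}" Cs]) auto
  next
    case 2
    then show ?thesis
      using g2 min by (intro lead[of "{Cs, Ct, Cx1 ?a}" "Cx1 ?a"]) auto
  next
    case 3
    then show ?thesis
      using g3 min by (intro lead[of "{Cs, Ct, Cx2 ?b}" "Cx2 ?b"]) auto
  qed
qed

section \<open>Congruence classes of monomials modulo the join-meet ideal\<close>

definition exp1 :: "(('a::finite, 'b) crystal \<Rightarrow>\<^sub>0 nat) \<Rightarrow> nat" where
  "exp1 u = (\<Sum>r\<in>UNIV. Poly_Mapping.lookup u (Cx1 r))"

definition exp2 :: "(('a, 'b::finite) crystal \<Rightarrow>\<^sub>0 nat) \<Rightarrow> nat" where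
  "exp2 u = (\<Sum>q\<in>UNIV. Poly_Mapping.lookup u (Cx2 q))"

lemma exp_add: "exp1 (u + v) = exp1 u + exp1 v" "exp2 (u + v) = exp2 u + exp2 v"
  by (simp_all add: exp1_def exp2_def lookup_add sum.distrib)

lemma exp_single:
  "exp1 (Poly_Mapping.single x n) = (n when x \<in> range Cx1)"
  "exp2 (Poly_Mapping.single x n) = (n when x \<in> range Cx2)"
  by (cases x; auto simp: exp1_def exp2_def lookup_single when_def)+

lemma exp_eq_0_iff:
  "exp1 u = 0 \<longleftrightarrow> (\<forall>r. Poly_Mapping.lookup u (Cx1 r) = 0)"
  "exp2 u = 0 \<longleftrightarrow> (\<forall>q. Poly_Mapping.lookup u (Cx2 q) = 0)"
  by (auto simp: exp1_def exp2_def)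

lemma mono_deg_crystal:
  fixes u :: "('a::finite, 'b::finite) crystal \<Rightarrow>\<^sub>0 nat"
  shows "mono_deg u = Poly_Mapping.lookup u Cs + Poly_Mapping.lookup u Ct + exp1 u + exp2 u"
proof -
  have "mono_deg u = (\<Sum>x\<in>insert Cs (insert Ct (range Cx1 \<union> range Cx2)). Poly_Mapping.lookup u x)"
    by (rule mono_deg_eq_sum) (auto simp flip: UNIV_crystal)
  also have "\<dots> = Poly_Mapping.lookup u Cs + (Poly_Mapping.lookup u Ct +
      (sum (Poly_Mapping.lookup u) (range Cx1) + sum (Poly_Mapping.lookup u) (range Cx2)))"
    by (subst sum.insert; (subst sum.insert)?; (subst sum.union_disjoint)?; auto)
  finally show ?thesis
    by (simp add: exp1_def exp2_def sum.reindex inj_def)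
qed

text \<open>The complete invariant of monomials modulo the binomial ideal \<open>join_meet_ideal\<close>: a monomial divisible
  neither by \<open>s t\<close> nor by any \<open>x\<^bsub>1,r\<^esub> x\<^bsub>2,q\<^esub>\<close> is congruent only to itself; for all others, every
  \<open>x\<^bsub>1,r\<^esub> x\<^bsub>2,q\<^esub>\<close> may be replaced by \<open>s t\<close>, and then the variables within a chain are interchangeable.\<close>

definition isolated :: "(('a::finite, 'b::finite) crystal \<Rightarrow>\<^sub>0 nat) \<Rightarrow> bool" where
  "isolated u \<longleftrightarrow> (Poly_Mapping.lookup u Cs = 0 \<or> Poly_Mapping.lookup u Ct = 0) \<and> (exp1 u = 0 \<or> exp2 u = 0)"

definition monomial_class :: "(('a::finite, 'b::finite) crystal \<Rightarrow>\<^sub>0 nat) \<Rightarrow>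
    (('a, 'b) crystal \<Rightarrow>\<^sub>0 nat) + nat \<times> nat \<times> nat \<times> nat" where
  "monomial_class u = (if isolated u then Inl u else let k = min (exp1 u) (exp2 u) in
     Inr (Poly_Mapping.lookup u Cs + k, Poly_Mapping.lookup u Ct + k, exp1 u - k, exp2 u - k))"

text \<open>A comparable pair is only permuted by join and meet. Replacing x_{1,r} x_{2,q} by s t
  lowers both chain degrees, hence their minimum k, by one and raises the exponents of s and t by
  one; the four recorded numbers do not change, and neither monomial is isolated.\<close>

lemma monomial_class_relation:
  fixes u :: "('a::{finite,linorder}, 'b::{finite,linorder}) crystal \<Rightarrow>\<^sub>0 nat"
  shows "monomial_class (u + (Poly_Mapping.single x 1 + Poly_Mapping.single y 1)) =
    monomial_class (u + (Poly_Mapping.single (sup x y) 1 + Poly_Mapping.single (inf x y) 1))"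
proof -
  have *: "monomial_class (u + (Poly_Mapping.single (Cx1 r) 1 + Poly_Mapping.single (Cx2 q) 1)) =
      monomial_class (u + (Poly_Mapping.single Ct 1 + Poly_Mapping.single Cs 1))" for r q
  proof -
    let ?v = "u + (Poly_Mapping.single (Cx1 r) 1 + Poly_Mapping.single (Cx2 q) 1)"
    let ?w = "u + (Poly_Mapping.single Ct 1 + Poly_Mapping.single Cs 1)"
    have "exp1 ?v = Suc (exp1 u)" "exp2 ?v = Suc (exp2 u)" "exp1 ?w = exp1 u" "exp2 ?w = exp2 u"
      by (auto simp: exp_add exp_single when_def)
    moreover have "Poly_Mapping.lookup ?v Cs = Poly_Mapping.lookup u Cs" "Poly_Mapping.lookup ?v Ct = Poly_Mapping.lookup u Ct"
      "Poly_Mapping.lookup ?w Cs = Suc (Poly_Mapping.lookup u Cs)" "Poly_Mapping.lookup ?w Ct = Suc (Poly_Mapping.lookup u Ct)"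
      by (simp_all add: lookup_add lookup_single when_def)
    ultimately show ?thesis
      unfolding monomial_class_def isolated_def Let_def by (simp only:) simp
  qed
  show ?thesis
  proof (cases x; cases y)
    fix r q assume "x = Cx1 r" "y = Cx2 q"
    then show ?thesis using *[of r q] by simp
  next
    fix r q assume "x = Cx2 q" "y = Cx1 r"
    then show ?thesis using *[of r q] by (simp add: add.commute[of "Poly_Mapping.single (Cx2 q) _"])
  qed (auto simp: max_def min_def add.commute)
qed

definition class_sum :: "('u \<Rightarrow> 'c) \<Rightarrow> 'c \<Rightarrow> ('u \<Rightarrow>\<^sub>0 'k::comm_monoid_add) \<Rightarrow> 'k" where
  "class_sum cl c f = (\<Sum>u\<in>Poly_Mapping.keys f. Poly_Mapping.lookup f u when cl u = c)"

lemma class_sum_add: "class_sum cl c (f + g) = class_sum cl c f + class_sum cl c g"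
  unfolding class_sum_def by (rule setsum_keys_plus_distrib) (auto simp: when_def)

lemma class_sum_0: "class_sum cl c 0 = 0"
  by (simp add: class_sum_def)

lemma class_sum_sum: "class_sum cl c (sum f A) = (\<Sum>i\<in>A. class_sum cl c (f i))"
  by (induction A rule: infinite_finite_induct) (simp_all add: class_sum_add class_sum_0)

lemma class_sum_single: "class_sum cl c (Poly_Mapping.single u x) = (x when cl u = c)"
  by (auto simp: class_sum_def)

text \<open>Every monomial multiple of a generator is a difference of two monomials of the same
  class, so its contributions cancel.\<close>

lemma class_sum_join_meet_ideal:
  fixes f :: "(('a::{finite,linorder}, 'b::{finite,linorder}) crystal, 'k::field) mpoly"
  assumes "f \<in> join_meet_ideal"
  shows "class_sum monomial_class c f = 0"
proof -
  \<comment> \<open>Quantifying over all multiples h makes this set an ideal; the kernel of the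
    functional alone is only seen to be a subspace over the field.\<close>
  let ?N = "{f :: (('a, 'b) crystal, 'k) mpoly. \<forall>h. class_sum monomial_class c (h * f) = 0}"
  have "join_meet_ideal \<subseteq> ?N"
    unfolding join_meet_ideal_def
  proof (rule ideal_gen_minimal)
    show "Modules.module.subspace (*) ?N"
      unfolding Modules.module.subspace_def[OF module_mult]
      by (auto simp: distrib_left class_sum_add class_sum_0 mult.assoc[symmetric])
    show "{mpvar x * mpvar y - mpvar (sup x y) * mpvar (inf x y) | x y :: ('a, 'b) crystal. True} \<subseteq> ?N"
    proof safe
      fix x y :: "('a, 'b) crystal" and h :: "(('a, 'b) crystal, 'k) mpoly"
      let ?u = "Poly_Mapping.single x (1::nat) + Poly_Mapping.single y 1"
      let ?v = "Poly_Mapping.single (sup x y) (1::nat) + Poly_Mapping.single (inf x y) 1"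
      have "h * (mpvar x * mpvar y - mpvar (sup x y) * mpvar (inf x y)) =
          h * (Poly_Mapping.single ?u 1 + Poly_Mapping.single ?v (- 1))"
        by (simp add: mpvar_def mult_single single_uminus)
      also have "\<dots> = (\<Sum>w\<in>Poly_Mapping.keys h. Poly_Mapping.single (w + ?u) (Poly_Mapping.lookup h w) +
          Poly_Mapping.single (w + ?v) (- Poly_Mapping.lookup h w))"
        by (subst poly_mapping_sum_single[of h])
          (simp add: sum_distrib_right distrib_left mult_single)
      also have "class_sum monomial_class c \<dots> = 0"
        by (simp only: class_sum_sum class_sum_add class_sum_single monomial_class_relation[of _ x y])
          (simp add: when_def)
      finally show "class_sum monomial_class c (h * (mpvar x * mpvar y - mpvar (sup x y) * mpvar (inf x y))) = 0" .
    qed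
  qed
  then have "class_sum monomial_class c (1 * f) = 0"
    using assms by blast
  then show ?thesis by simp
qed

text \<open>A standard monomial that is not alone in its class has already traded every x_{1,r}
  x_{2,q} for s t and pushed its chain degree to the smallest variable of the chain. Both moves
  raise exponents of the smallest possible variables, which makes a monomial small in reverse
  lexicographic order.\<close>

lemma standard_monomial_minimal:
  fixes m k :: "('a::{finite,linorder}, 'b::{finite,linorder}) crystal \<Rightarrow>\<^sub>0 nat"
  assumes std: "\<not> (\<exists>W\<in>crystal_gens. W \<subseteq> Poly_Mapping.keys m)"
    and cl: "monomial_class k = monomial_class m" and ne: "k \<noteq> m"
  shows "\<not> revlex_less crystal_var_less k m"
proof
  assume less: "revlex_less crystal_var_less k m"
  let ?a = "Min UNIV :: 'a" and ?b = "Min UNIV :: 'b"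
  let ?l = "Poly_Mapping.lookup"
  have iso: "\<not> isolated m" "\<not> isolated k"
    using cl ne by (auto simp: monomial_class_def Let_def split: if_splits)
  have std': "?l m (Cx1 r) = 0 \<or> ?l m (Cx2 q) = 0" "?a < r \<Longrightarrow> ?l m Cs = 0 \<or> ?l m Ct = 0 \<or> ?l m (Cx1 r) = 0"
    "?b < q \<Longrightarrow> ?l m Cs = 0 \<or> ?l m Ct = 0 \<or> ?l m (Cx2 q) = 0" for r q
  proof -
    have "{Cx1 r, Cx2 q} \<in> crystal_gens" "?a < r \<Longrightarrow> {Cs, Ct, Cx1 r} \<in> crystal_gens"
      "?b < q \<Longrightarrow> {Cs, Ct, Cx2 q} \<in> crystal_gens"
      unfolding crystal_gens_def by blast+
    with std have "\<not> {Cx1 r, Cx2 q} \<subseteq> Poly_Mapping.keys m" "?a < r \<Longrightarrow> \<not> {Cs, Ct, Cx1 r} \<subseteq> Poly_Mapping.keys m"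
      "?b < q \<Longrightarrow> \<not> {Cs, Ct, Cx2 q} \<subseteq> Poly_Mapping.keys m"
      by blast+
    then show "?l m (Cx1 r) = 0 \<or> ?l m (Cx2 q) = 0" "?a < r \<Longrightarrow> ?l m Cs = 0 \<or> ?l m Ct = 0 \<or> ?l m (Cx1 r) = 0"
      "?b < q \<Longrightarrow> ?l m Cs = 0 \<or> ?l m Ct = 0 \<or> ?l m (Cx2 q) = 0"
      by (simp_all add: in_keys_iff)
  qed
  have 0: "exp1 m = 0 \<or> exp2 m = 0"
    using std'(1) by (metis exp_eq_0_iff)
  then have st: "?l m Cs \<noteq> 0" "?l m Ct \<noteq> 0"
    using iso(1) by (auto simp: isolated_def)
  have min: "?a \<le> r" "?b \<le> q" for r q
    by (rule Min_le[OF finite UNIV_I])+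
  \<comment> \<open>As s t divides m, a standard m contains no chain variable other than the minimum
    of a chain.\<close>
  have m1: "exp1 m = ?l m (Cx1 ?a)"
  proof -
    have "?l m (Cx1 r) = 0" if "r \<noteq> ?a" for r
      using std'(2)[of r] st le_neq_trans[OF min(1) that[symmetric]] by simp
    then have "exp1 m = (\<Sum>r\<in>{?a}. ?l m (Cx1 r))"
      unfolding exp1_def by (intro sum.mono_neutral_right) auto
    then show ?thesis by simp
  qed
  have m2: "exp2 m = ?l m (Cx2 ?b)"
  proof -
    have "?l m (Cx2 q) = 0" if "q \<noteq> ?b" for q
      using std'(3)[of q] st le_neq_trans[OF min(2) that[symmetric]] by simp
    then have "exp2 m = (\<Sum>q\<in>{?b}. ?l m (Cx2 q))"
      unfolding exp2_def by (intro sum.mono_neutral_right) auto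
    then show ?thesis by simp
  qed
  \<comment> \<open>Once the chain degrees of k and m agree, these bounds leave k no larger exponent
    at the minimum, and no further variable if it agrees with m there.\<close>
  have k1: "?l k (Cx1 ?a) + (if r = ?a then 0 else ?l k (Cx1 r)) \<le> exp1 k" for r
  proof -
    have "(\<Sum>r\<in>{?a, r}. ?l k (Cx1 r)) \<le> exp1 k"
      unfolding exp1_def by (rule sum_mono2) auto
    then show ?thesis by (auto split: if_splits)
  qed
  have k2: "?l k (Cx2 ?b) + (if q = ?b then 0 else ?l k (Cx2 q)) \<le> exp2 k" for q
  proof -
    have "(\<Sum>q\<in>{?b, q}. ?l k (Cx2 q)) \<le> exp2 k"
      unfolding exp2_def by (rule sum_mono2) auto
    then show ?thesis by (auto split: if_splits)
  qed
  have eq: "?l k Cs + min (exp1 k) (exp2 k) = ?l m Cs" "?l k Ct + min (exp1 k) (exp2 k) = ?l m Ct"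
    "exp1 k = exp1 m + min (exp1 k) (exp2 k)" "exp2 k = exp2 m + min (exp1 k) (exp2 k)"
    using cl iso 0 by (auto simp: monomial_class_def Let_def)
  then have "mono_deg k = mono_deg m"
    by (simp add: mono_deg_crystal)
  then obtain x where x: "?l k x > ?l m x" "\<And>y. crystal_var_less y x \<Longrightarrow> ?l k y = ?l m y"
    using less by (auto simp: revlex_less_def)
  have Cs: "x \<noteq> Cs"
    using x(1) eq(1) by auto
  \<comment> \<open>The variable s lies below x, so the exponents of s agree; hence
    \<open>min (exp1 k) (exp2 k)\<close> is 0, and the remaining invariants agree as well.\<close>
  then have "?l k Cs = ?l m Cs"
    by (intro x(2)) (cases x; simp)
  then have eq': "?l k Ct = ?l m Ct" "exp1 k = exp1 m" "exp2 k = exp2 m"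
    using eq by simp_all
  show False
  proof (cases x)
    case (Cx1 r)
    have "?l k (Cx1 ?a) = ?l m (Cx1 ?a)" if "r \<noteq> ?a"
      using le_neq_trans[OF min(1) that[symmetric]] by (intro x(2)) (simp add: Cx1)
    then show False
      using k1[of r] x(1) eq'(2) m1 by (auto simp: Cx1 split: if_splits)
  next
    case (Cx2 q)
    have "?l k (Cx2 ?b) = ?l m (Cx2 ?b)" if "q \<noteq> ?b"
      using le_neq_trans[OF min(2) that[symmetric]] by (intro x(2)) (simp add: Cx2)
    then show False
      using k2[of q] x(1) eq'(3) m2 by (auto simp: Cx2 split: if_splits)
  qed (use Cs x(1) eq'(1) in auto)
qed

theorem crystal_initial_ideal_eq:
  "(crystal_initial_ideal :: (('a::{finite,linorder}, 'b::{finite,linorder}) crystal, 'k::field) mpoly set) =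
    sqfree_ideal crystal_gens"
proof -
  let ?L = "revlex_less crystal_var_less :: (('a, 'b) crystal \<Rightarrow>\<^sub>0 nat) \<Rightarrow> _"
  define M where "M = {m. \<exists>f\<in>(join_meet_ideal :: (('a, 'b) crystal, 'k) mpoly set). f \<noteq> 0 \<and> is_leading_monomial ?L f m}"
  have gens: "\<exists>W\<in>crystal_gens. W \<subseteq> Poly_Mapping.keys m" if m: "m \<in> M" for m
  proof (rule ccontr)
    assume std: "\<not> (\<exists>W\<in>crystal_gens. W \<subseteq> Poly_Mapping.keys m)"
    obtain f :: "(('a, 'b) crystal, 'k) mpoly" where f: "f \<in> join_meet_ideal" "m \<in> Poly_Mapping.keys f"
      "\<And>k. k \<in> Poly_Mapping.keys f \<Longrightarrow> k \<noteq> m \<Longrightarrow> ?L k m"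
      using m unfolding M_def is_leading_monomial_def by blast
    \<comment> \<open>All other monomials of f are smaller than m, hence not in the class of the
      standard monomial m; the class sum is then the leading coefficient, which cannot
      vanish.\<close>
    have "class_sum monomial_class (monomial_class m) f =
        (\<Sum>k\<in>{m}. Poly_Mapping.lookup f k when monomial_class k = monomial_class m)"
      unfolding class_sum_def using f(2,3) standard_monomial_minimal[OF std]
      by (intro sum.mono_neutral_right) (auto simp: when_def)
    then show False
      using f(2) class_sum_join_meet_ideal[OF f(1)] by (simp add: in_keys_iff)
  qed
  have "(\<exists>m\<in>M. \<exists>u. k = m + u) \<longleftrightarrow> (\<exists>W\<in>crystal_gens. W \<subseteq> Poly_Mapping.keys k)" for k
  proof
    assume "\<exists>m\<in>M. \<exists>u. k = m + u"
    then show "\<exists>W\<in>crystal_gens. W \<subseteq> Poly_Mapping.keys k"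
      using gens by (metis keys_add_nat le_supI1)
  next
    assume "\<exists>W\<in>crystal_gens. W \<subseteq> Poly_Mapping.keys k"
    then obtain W where "W \<in> crystal_gens" "\<exists>u. k = sqfree_mono W + u"
      unfolding sqfree_mono_dvd_iff by blast
    then show "\<exists>m\<in>M. \<exists>u. k = m + u"
      using crystal_gens_initial[of W, where 'k = 'k] unfolding M_def by blast
  qed
  moreover have "crystal_initial_ideal = ideal_gen {Poly_Mapping.single m (1 :: 'k) | m. m \<in> M}"
    by (simp add: crystal_initial_ideal_def initial_ideal_def M_def)
  ultimately show ?thesis
    by (simp add: ideal_gen_monomials sqfree_ideal_def)
qed

section \<open>Betti numbers\<close>

text \<open>The generators are indexed by triples, ordered lexicographically: \<open>(0, r, q)\<close> stands for
  \<open>x\<^bsub>1,r\<^esub> x\<^bsub>2,q\<^esub>\<close>, \<open>(1, r, _)\<close> for \<open>s t x\<^bsub>1,r\<^esub>\<close> and \<open>(2, _, q)\<close> for \<open>s t x\<^bsub>2,q\<^esub>\<close>.\<close>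

definition gen_index :: "(nat \<times> 'a::{finite,linorder} \<times> 'b::{finite,linorder}) set" where
  "gen_index = {0} \<times> UNIV \<times> UNIV \<union> {1} \<times> {Min UNIV<..} \<times> {Min UNIV} \<union> {2} \<times> {Min UNIV} \<times> {Min UNIV<..}"

fun gen_support :: "nat \<times> 'a \<times> 'b \<Rightarrow> ('a, 'b) crystal set" where
  "gen_support (n, r, q) = (if n = 0 then {Cx1 r, Cx2 q} else if n = 1 then {Cs, Ct, Cx1 r} else {Cs, Ct, Cx2 q})"

text \<open>For s t x_{1,r}, the earlier x_{1,r} x_{2,q} yields x_{2,q}, and the earlier s t
  x_{1,r'} yields x_{1,r'}; the case of s t x_{2,q} is analogous.\<close>

fun gen_colon :: "nat \<times> 'a::{finite,linorder} \<times> 'b::{finite,linorder} \<Rightarrow> ('a, 'b) crystal set" where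
  "gen_colon (n, r, q) = (if n = 0 then Cx1 ` {..<r} \<union> Cx2 ` {..<q}
     else if n = 1 then Cx1 ` {Min UNIV<..<r} \<union> range Cx2
     else range Cx1 \<union> Cx2 ` {Min UNIV<..<q})"

lemma gen_support_image: "gen_support ` gen_index = crystal_gens"
  unfolding gen_index_def crystal_gens_def image_Un
  by (intro arg_cong2[of _ _ _ _ "(\<union>)"]) (force simp: image_iff)+

lemma finite_gen_index: "finite gen_index"
  by (simp add: gen_index_def)

lemma bex_gen_index:
  "(\<exists>a\<in>gen_index. P a) \<longleftrightarrow> (\<exists>r q. P (0, r, q)) \<or> (\<exists>r>Min UNIV. P (1, r, Min UNIV)) \<or>
    (\<exists>q>Min UNIV. P (2, Min UNIV, q))"
  unfolding gen_index_def bex_Un by (simp add: Bex_def)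

lemma gen_colon:
  fixes b :: "nat \<times> 'a::{finite,linorder} \<times> 'b::{finite,linorder}"
  assumes b: "b \<in> gen_index"
  shows "(\<exists>a\<in>gen_index. a < b \<and> gen_support a \<subseteq> T \<union> gen_support b) \<longleftrightarrow> T \<inter> gen_colon b \<noteq> {}"
proof -
  obtain n r q where nrq: "b = (n, r, q)" by (cases b)
  from b consider "n = 0" | "n = 1" "Min UNIV < r" "q = Min UNIV" | "n = 2" "r = Min UNIV" "Min UNIV < q"
    by (auto simp: gen_index_def nrq)
  then show ?thesis
  proof cases
    case 1
    have "(\<exists>a\<in>gen_index. a < b \<and> gen_support a \<subseteq> T \<union> gen_support b) \<longleftrightarrow>
        (\<exists>r' q'. (r' < r \<or> r' \<le> r \<and> q' < q) \<and> {Cx1 r', Cx2 q'} \<subseteq> T \<union> {Cx1 r, Cx2 q})"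
      unfolding bex_gen_index nrq 1 by simp
    \<comment> \<open>An earlier pair has a smaller entry in at least one coordinate, and that
      variable must come from T; conversely, keep the other coordinate equal.\<close>
    also have "\<dots> \<longleftrightarrow> (\<exists>r'<r. Cx1 r' \<in> T) \<or> (\<exists>q'<q. Cx2 q' \<in> T)"
      by fastforce
    finally show ?thesis
      by (auto simp: nrq 1)
  next
    case 2
    have "(\<exists>a\<in>gen_index. a < b \<and> gen_support a \<subseteq> T \<union> gen_support b) \<longleftrightarrow>
        (\<exists>r' q'. {Cx1 r', Cx2 q'} \<subseteq> T \<union> {Cs, Ct, Cx1 r}) \<or>
        (\<exists>r'. Min UNIV < r' \<and> r' < r \<and> {Cs, Ct, Cx1 r'} \<subseteq> T \<union> {Cs, Ct, Cx1 r})"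
      unfolding bex_gen_index nrq 2 by simp
    also have "\<dots> \<longleftrightarrow> (\<exists>q'. Cx2 q' \<in> T) \<or> (\<exists>r'. Min UNIV < r' \<and> r' < r \<and> Cx1 r' \<in> T)"
      by fastforce
    finally show ?thesis
      by (auto simp: nrq 2)
  next
    case 3
    have "(\<exists>a\<in>gen_index. a < b \<and> gen_support a \<subseteq> T \<union> gen_support b) \<longleftrightarrow>
        (\<exists>r' q'. {Cx1 r', Cx2 q'} \<subseteq> T \<union> {Cs, Ct, Cx2 q}) \<or>
        (\<exists>r'. Min UNIV < r' \<and> {Cs, Ct, Cx1 r'} \<subseteq> T \<union> {Cs, Ct, Cx2 q}) \<or>
        (\<exists>q'. Min UNIV < q' \<and> q' < q \<and> {Cs, Ct, Cx2 q'} \<subseteq> T \<union> {Cs, Ct, Cx2 q})"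
      unfolding bex_gen_index nrq 3 by simp
    also have "\<dots> \<longleftrightarrow> (\<exists>r'. Cx1 r' \<in> T) \<or> (\<exists>q'. Min UNIV < q' \<and> q' < q \<and> Cx2 q' \<in> T)"
      by fastforce
    finally show ?thesis
      by (auto simp: nrq 3)
  qed
qed

text \<open>The hockey-stick identity, with the rank of r expressed by counting smaller elements
  since the chain is an abstract finite order; adding a new maximum is one application of Pascal's
  rule.\<close>

lemma sum_choose_card_less:
  fixes A :: "'a::linorder set"
  assumes "finite A"
  shows "(\<Sum>r\<in>A. card {r'\<in>A. r' < r} choose i) = card A choose Suc i"
  using assms
proof (induction A rule: finite_linorder_max_induct)
  case (insert b A)
  have "{r' \<in> insert b A. r' < r} = {r' \<in> A. r' < r}" if "r \<in> A" for r
    using insert.hyps(2) that by auto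
  moreover have "{r' \<in> insert b A. r' < b} = A"
    using insert.hyps(2) by auto
  moreover have "b \<notin> A"
    using insert.hyps(2) by auto
  ultimately show ?case
    using insert.hyps(1) insert.IH by (simp cong: sum.cong)
qed simp

lemma card_lessThan_Max_UNIV: "card {..<Max UNIV :: 'c::{finite,linorder}} = CARD('c) - 1"
proof -
  have "r \<noteq> Max UNIV \<longleftrightarrow> r < Max UNIV" for r :: 'c
    using Max_ge[OF finite UNIV_I, of r] by (metis less_le)
  then have "{..<Max UNIV :: 'c} = UNIV - {Max UNIV}"
    by blast
  then show ?thesis
    by (simp only: card_Diff_singleton UNIV_I if_True)
qed

lemma crystal_minimal_resolution:
  "\<exists>D A. min_res (crystal_initial_ideal :: (('a::{finite,linorder}, 'b::{finite,linorder}) crystal, 'k::field) mpoly set) D A \<and>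
    (\<forall>i. length (D (Suc i)) = (\<Sum>b\<in>(gen_index :: (nat \<times> 'a \<times> 'b) set). card (gen_colon b) choose i))"
  unfolding crystal_initial_ideal_eq gen_support_image[symmetric]
proof (rule min_res_linear_quotients)
  show "finite (gen_index :: (nat \<times> 'a \<times> 'b) set)"
    by (rule finite_gen_index)
  fix a b :: "nat \<times> 'a \<times> 'b"
  show "gen_support b \<noteq> {}"
    by (cases b) simp
  \<comment> \<open>The leading component of the index puts the quadratic generators before the
    cubic ones.\<close>
  show "card (gen_support a) \<le> card (gen_support b)" if "a < b"
    using that by (cases a; cases b) auto
qed (rule gen_colon)

text \<open>Existence of some resolution makes the chosen shifts belong to one; comparing ranks in
  both directions gives equality.\<close>

lemma minimal_shifts_length:
  assumes "min_res I D A"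
  shows "length (minimal_shifts I i) = length (D i)"
proof -
  have "\<exists>D A. minimal_graded_free_resolution I D A"
    using assms unfolding min_res_def by blast
  then have "\<exists>A. minimal_graded_free_resolution I (minimal_shifts I) A"
    unfolding minimal_shifts_def by (rule someI_ex)
  then obtain A' where "min_res I (minimal_shifts I) A'"
    unfolding min_res_def by blast
  then show ?thesis
    using min_res_rank_le assms by (metis order_antisym)
qed

lemma suminf_graded_betti_quot:
  "suminf (\<lambda>j. graded_betti_quot I i j) = length (minimal_shifts I i)"
proof -
  have "suminf (\<lambda>j. graded_betti_quot I i j) = (\<Sum>j\<in>set (minimal_shifts I i). graded_betti_quot I i j)"
    by (rule suminf_finite) (auto simp: graded_betti_quot_def count_list_0_iff)
  then show ?thesis
    by (simp add: graded_betti_quot_def sum_count_set)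
qed

theorem theorem1p2:
  fixes I :: "(('a::{finite,linorder}, 'b::{finite,linorder}) crystal, 'k::field) mpoly set"
    and n1 n2 :: nat
  assumes n1: "n1 = CARD('a)" and n2: "n2 = CARD('b)"
    and I: "I = crystal_initial_ideal"
  shows "enat (max n1 n2) \<le> proj_dim_quot I \<and>
         proj_dim_quot I \<le> enat (n1 + n2 + 1) \<and>
         (\<forall>i\<in>{1..n1}. n1 choose i \<le> suminf (\<lambda>j. graded_betti_quot I i j))"
proof -
  let ?X = "gen_index :: (nat \<times> 'a \<times> 'b) set" and ?S = "minimal_shifts I"
  have len: "length (?S (Suc i)) = (\<Sum>b\<in>?X. card (gen_colon b) choose i)" for i
  proof -
    obtain D A where "min_res I D A" "\<And>i. length (D (Suc i)) = (\<Sum>b\<in>?X. card (gen_colon b) choose i)"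
      using crystal_minimal_resolution unfolding I by blast
    then show ?thesis
      by (simp add: minimal_shifts_length)
  qed
  have pos: "n1 > 0" "n2 > 0"
    by (simp_all add: n1 n2 finite_UNIV_card_ge_0)
  have min: "{..<Min UNIV :: 'b} = {}"
    unfolding lessThan_def Collect_empty_eq not_less using Min_le[OF finite UNIV_I] by blast
  have betti: "n1 choose Suc i \<le> length (?S (Suc i))" for i
  proof -
    \<comment> \<open>Only the generators x_{1,r} x_{2,1} are kept: their colon ideals have 0, ...,
      n_1 - 1 variables, and all other contributions are nonnegative.\<close>
    have "n1 choose Suc i = (\<Sum>r\<in>(UNIV :: 'a set). card {..<r} choose i)"
      using sum_choose_card_less[of "UNIV :: 'a set" i] by (simp add: n1 lessThan_def)
    also have "\<dots> = (\<Sum>r\<in>(UNIV :: 'a set). card (gen_colon (0, r, Min UNIV :: 'b)) choose i)"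
      by (simp add: min card_image inj_on_def)
    also have "\<dots> = (\<Sum>b\<in>(\<lambda>r. (0, r, Min UNIV) :: nat \<times> 'a \<times> 'b) ` UNIV. card (gen_colon b) choose i)"
      by (subst sum.reindex) (auto simp: inj_on_def)
    also have "\<dots> \<le> length (?S (Suc i))"
      unfolding len by (rule sum_mono2[OF finite_gen_index]) (auto simp: gen_index_def)
    finally show ?thesis .
  qed
  have "?S (n1 + n2 - 1) \<noteq> []"
  proof -
    let ?b = "(0, Max UNIV :: 'a, Max UNIV :: 'b) :: nat \<times> 'a \<times> 'b"
    have "card (gen_colon ?b) = card (Cx1 ` {..<Max UNIV :: 'a} :: ('a, 'b) crystal set) +
        card (Cx2 ` {..<Max UNIV :: 'b} :: ('a, 'b) crystal set)"
      by (simp, subst card_Un_disjoint) auto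
    also have "\<dots> = (n1 - 1) + (n2 - 1)"
      by (simp add: card_image inj_on_def card_lessThan_Max_UNIV n1 n2)
    finally have "card (gen_colon ?b) choose (n1 - 1 + (n2 - 1)) = 1"
      by simp
    moreover have "card (gen_colon ?b) choose (n1 - 1 + (n2 - 1)) \<le> length (?S (Suc (n1 - 1 + (n2 - 1))))"
      unfolding len by (rule member_le_sum[OF _ _ finite_gen_index]) (auto simp: gen_index_def)
    moreover have "Suc (n1 - 1 + (n2 - 1)) = n1 + n2 - 1"
      using pos by simp
    ultimately have "1 \<le> length (?S (n1 + n2 - 1))"
      by (simp only:)
    then show ?thesis
      by auto
  qed
  then have "enat (n1 + n2 - 1) \<le> proj_dim_quot I"
    unfolding proj_dim_quot_def by (intro SUP_upper) simp
  \<comment> \<open>Both chains are nonempty, so the smaller of n_1 and n_2 absorbs the -1.\<close>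
  moreover have "enat (max n1 n2) \<le> enat (n1 + n2 - 1)"
    using pos by (simp, arith)
  moreover have "i \<le> n1 + n2 + 1" if "?S i \<noteq> []" for i
  proof (rule ccontr)
    assume "\<not> i \<le> n1 + n2 + 1"
    then obtain j where j: "i = Suc j" "n1 + n2 < j"
      by (cases i) auto
    \<comment> \<open>Colon ideals involve chain variables only, never s or t, so the binomials with
      lower index j > n_1 + n_2 vanish. The extra 1 in the bound is the index shift from j to i = j
      + 1.\<close>
    have "card (gen_colon b) < j" for b :: "nat \<times> 'a \<times> 'b"
    proof -
      have "card (gen_colon b) \<le> card (range Cx1 \<union> range Cx2 :: ('a, 'b) crystal set)"
        by (cases b, rule card_mono) auto
      also have "\<dots> \<le> n1 + n2"
        by (rule order_trans[OF card_Un_le]) (simp add: card_image inj_def n1 n2)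
      finally show ?thesis
        using j(2) by simp
    qed
    then have "length (?S i) = 0"
      unfolding j(1) len by (simp add: binomial_eq_0)
    then show False
      using that by simp
  qed
  then have "proj_dim_quot I \<le> enat (n1 + n2 + 1)"
    unfolding proj_dim_quot_def by (intro SUP_least) simp
  moreover have "n1 choose i \<le> suminf (\<lambda>j. graded_betti_quot I i j)" if "i \<in> {1..n1}" for i
    using betti[of "i - 1"] that by (simp add: suminf_graded_betti_quot)
  ultimately show ?thesis
    by (meson order_trans)
qed

end
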